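(* Let $M$ be an irreducible generator on the finite state space $\mathcal Z$. Then for any $\delta\in(0,1)$ there exists $\alpha_*>0$ such that for all initial data $\zeta_0,\mu_0\in\mathcal P(\mathcal Z)$ and corresponding solutions $\zeta_t,\mu_t$ of the forward Kolmogorov equation $\frac{\mathrm d}{\mathrm dt}\nu_t=M^T\nu_t$ it holds that $$0<\alpha_*\le\alpha_{\mathrm{gLSI}}(\zeta_t)\le2\alpha_{\mathrm{gPI}}(\zeta_t)$$ for all $t\ge\delta$, and $$\operatorname{var}_{\zeta_t}\Bigl(\frac{\mu_t}{\zeta_t}\Bigr)\le\operatorname{var}_{\zeta_0}\Bigl(\frac{\mu_0}{\zeta_0}\Bigr)\min\bigl(1,e^{-\alpha_*(t-\delta)}\bigr),\qquad \mathscr H_{\zeta_t}\Bigl(\frac{\mu_t}{\zeta_t}\Bigr)\le\mathscr H_{\zeta_0}\Bigl(\frac{\mu_0}{\zeta_0}\Bigr)\min\bigl(1,e^{-\alpha_*(t-\delta)}\bigr)$$ for all $t\ge0$.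
   Context: $\mathcal Z$ is a finite set with $|\mathcal Z|\ge2$. A generator is a matrix $M\in\mathbb R^{|\mathcal Z|\times|\mathcal Z|}$ with off-diagonal entries $\ge0$ and rows summing to $0$; reversibility is not assumed. $\mathcal P(\mathcal Z)$ and $\mathcal P_+(\mathcal Z)$ are the sets of probability measures and strictly positive probability measures on $\mathcal Z$ (viewed as vectors in $\mathbb R^{|\mathcal Z|}$); for $t>0$ solutions of the forward Kolmogorov equation starting in $\mathcal P(\mathcal Z)$ lie in $\mathcal P_+(\mathcal Z)$. $\mathbf 1$ is the constant function $1$, with span $\langle\mathbf 1\rangle$. For $\zeta\in\mathcal P_+(\mathcal Z)$: $\mathbb E_\zeta[f]=\sum_z f(z)\zeta(z)$; $\operatorname{var}_\zeta(f)=\mathbb E_\zeta[f^2]-(\mathbb E_\zeta[f])^2$; $\mathcal D_\zeta(\mathcal Z)=\{\varphi\in\mathbb R^{|\mathcal Z|}:\varphi(z)>0\ \forall z,\ \mathbb E_\zeta[\varphi]=1\}$; $\mathscr H_\zeta(\varphi)=\sum_z\varphi(z)\log\varphi(z)\,\zeta(z)$ with $0\log0=0$; $\mathscr E_\zeta(f)=\tfrac12\sum_{z,z'}M(z,z')\zeta(z)(f(z)-f(z'))^2$; $\mathscr R_\zeta(\varphi)=\sum_{z,z'}M(z,z')\zeta(z)\varphi(z)\bigl[\tfrac{\varphi(z')}{\varphi(z)}-1-\log\tfrac{\varphi(z')}{\varphi(z)}\bigr]$. Generalised constants: $$\alpha_{\mathrm{gPI}}(\zeta)=\inf_{f\in\mathbb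 R^{|\mathcal Z|},\,f\notin\langle\mathbf 1\rangle}\frac{\mathscr E_\zeta(f)}{\operatorname{var}_\zeta(f)},\qquad \alpha_{\mathrm{gLSI}}(\zeta)=\inf_{\varphi\in\mathcal D_\zeta(\mathcal Z),\,\varphi\ne\mathbf 1}\frac{\mathscr R_\zeta(\varphi)}{\mathscr H_\zeta(\varphi)}.$$ Convention when $\zeta_0$ has zeros: if $\mu_0$ is absolutely continuous with respect to $\zeta_0$, then $\operatorname{var}_{\zeta_0}(\mu_0/\zeta_0)$ and $\mathscr H_{\zeta_0}(\mu_0/\zeta_0)$ are computed by summing over the support of $\zeta_0$; otherwise both are $+\infty$. *)

theory Defs
  imports "HOL-Analysis.Analysis"
begin

definition generator :: "real^'z^'z \<Rightarrow> bool" where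
  "generator M \<longleftrightarrow>
     (\<forall>z z'. z \<noteq> z' \<longrightarrow> 0 \<le> M $ z $ z') \<and> (\<forall>z. (\<Sum>z'\<in>UNIV. M $ z $ z') = 0)"

text \<open>Strong connectedness of the directed graph of positive rates. The diagonal entries
  of a generator are nonpositive, so only genuine jumps contribute edges.\<close>

definition irreducible_gen :: "real^'z^'z \<Rightarrow> bool" where
  "irreducible_gen M \<longleftrightarrow> (\<forall>z z'. (z, z') \<in> {(x, y). 0 < M $ x $ y}\<^sup>*)"

definition prob_vecs :: "(real^'z) set" where
  "prob_vecs = {p. (\<forall>z. 0 \<le> p $ z) \<and> (\<Sum>z\<in>UNIV. p $ z) = 1}"

definition forward_solution :: "real^'z^'z \<Rightarrow> real^'z \<Rightarrow> (real \<Rightarrow> real^'z) \<Rightarrow> bool" where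
  "forward_solution M p \<nu> \<longleftrightarrow> \<nu> 0 = p \<and>
     (\<forall>t\<ge>0. (\<nu> has_vector_derivative (transpose M *v \<nu> t)) (at t within {0..}))"

definition expect :: "real^'z \<Rightarrow> real^'z \<Rightarrow> real" where
  "expect \<zeta> f = (\<Sum>z\<in>UNIV. f $ z * \<zeta> $ z)"

definition var :: "real^'z \<Rightarrow> real^'z \<Rightarrow> real" where
  "var \<zeta> f = expect \<zeta> (\<chi> z. (f $ z)\<^sup>2) - (expect \<zeta> f)\<^sup>2"

definition densities :: "real^'z \<Rightarrow> (real^'z) set" where
  "densities \<zeta> = {\<phi>. (\<forall>z. 0 < \<phi> $ z) \<and> expect \<zeta> \<phi> = 1}"

definition entropy :: "real^'z \<Rightarrow> real^'z \<Rightarrow> real" where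
  "entropy \<zeta> \<phi> = (\<Sum>z\<in>UNIV. \<phi> $ z * ln (\<phi> $ z) * \<zeta> $ z)"

definition dirichlet :: "real^'z^'z \<Rightarrow> real^'z \<Rightarrow> real^'z \<Rightarrow> real" where
  "dirichlet M \<zeta> f =
     (1/2) * (\<Sum>z\<in>UNIV. \<Sum>z'\<in>UNIV. M $ z $ z' * \<zeta> $ z * (f $ z - f $ z')\<^sup>2)"

definition fisher :: "real^'z^'z \<Rightarrow> real^'z \<Rightarrow> real^'z \<Rightarrow> real" where
  "fisher M \<zeta> \<phi> =
     (\<Sum>z\<in>UNIV. \<Sum>z'\<in>UNIV. M $ z $ z' * \<zeta> $ z * \<phi> $ z *
        (\<phi> $ z' / \<phi> $ z - 1 - ln (\<phi> $ z' / \<phi> $ z)))"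

text \<open>For strictly positive probability vectors \<open>\<zeta>\<close> and at least two states, the two
  infima below range over nonempty sets of nonnegative reals with nonzero denominators.
  The constants are not meant to be used for other \<open>\<zeta>\<close>.\<close>

definition gPI :: "real^'z^'z \<Rightarrow> real^'z \<Rightarrow> real" where
  "gPI M \<zeta> = (INF f \<in> {f. f \<notin> span {1}}. dirichlet M \<zeta> f / var \<zeta> f)"

definition gLSI :: "real^'z^'z \<Rightarrow> real^'z \<Rightarrow> real" where
  "gLSI M \<zeta> = (INF \<phi> \<in> densities \<zeta> - {1}. fisher M \<zeta> \<phi> / entropy \<zeta> \<phi>)"

definition abs_cont :: "real^'z \<Rightarrow> real^'z \<Rightarrow> bool" where
  "abs_cont \<mu> \<zeta> \<longleftrightarrow> (\<forall>z. \<zeta> $ z = 0 \<longrightarrow> \<mu> $ z = 0)"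

text \<open>Relative variance and entropy of \<open>\<mu>\<close> with respect to \<open>\<zeta>\<close>, which may have zeros. States
  outside the support of \<open>\<zeta>\<close> carry the weight \<open>\<zeta> $ z = 0\<close>, so the finite sums effectively
  range over the support, and the value of \<open>\<mu> $ z / \<zeta> $ z\<close> elsewhere is immaterial.\<close>

definition rel_var :: "real^'z \<Rightarrow> real^'z \<Rightarrow> ereal" where
  "rel_var \<zeta> \<mu> = (if abs_cont \<mu> \<zeta> then ereal (var \<zeta> (\<chi> z. \<mu> $ z / \<zeta> $ z)) else \<infinity>)"

definition rel_entropy :: "real^'z \<Rightarrow> real^'z \<Rightarrow> ereal" where
  "rel_entropy \<zeta> \<mu> = (if abs_cont \<mu> \<zeta> then ereal (entropy \<zeta> (\<chi> z. \<mu> $ z / \<zeta> $ z)) else \<infinity>)"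

end

theory Submission
  imports Defs "HOL-Real_Asymp.Real_Asymp"
begin

text \<open>Irreducibility transports mass along paths of positive rates, so all solutions are bounded
  below by a common \<open>c > 0\<close> for \<open>t \<ge> \<delta>\<close>. For \<open>\<zeta> \<ge> c\<close> every density is at most \<open>1 / c\<close>, whence
  \<open>x - 1 - ln x \<ge> (sqrt x - 1)\<^sup>2\<close> bounds \<open>fisher\<close> below by squared differences along the edges; these
  control the distance to \<open>1\<close> along paths, and \<open>entropy\<close> is at most quadratic in that distance.
  Along two solutions, the derivative of a \<open>\<zeta>\<close>-weighted sum of \<open>h (\<mu> / \<zeta>)\<close> is minus a sum of Bregman
  divergences of \<open>h\<close>: twice \<open>dirichlet\<close> for the variance and \<open>fisher\<close> for the entropy. Gronwall's
  inequality then gives the decay; the initial time is reached by continuity, because \<open>\<mu> / \<zeta>\<close>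
  stays bounded when \<open>\<mu>\<^sub>0\<close> is absolutely continuous.\<close>

subsection \<open>Positivity of solutions\<close>

lemma forward_solution_component:
  assumes "forward_solution M p x" "0 \<le> t"
  shows "((\<lambda>t. x t $ z) has_real_derivative (\<Sum>w\<in>UNIV. M $ w $ z * x t $ w)) (at t within {0..})"
proof -
  have "(x has_vector_derivative (transpose M *v x t)) (at t within {0..})"
    using assms by (auto simp: forward_solution_def)
  from bounded_linear.has_vector_derivative[OF bounded_linear_vec_nth[of z] this]
  show ?thesis
    by (simp add: has_real_derivative_iff_has_vector_derivative matrix_vector_mult_def transpose_def)
qed

lemma forward_solution_DERIV:
  assumes "forward_solution M p x" "0 < t"
  shows "((\<lambda>t. x t $ z) has_real_derivative (\<Sum>w\<in>UNIV. M $ w $ z * x t $ w)) (at t)"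
proof -
  have "at t within {0..} = at t"
    using assms(2) by (intro at_within_interior) auto
  with forward_solution_component[OF assms(1), of t z] assms(2) show ?thesis by simp
qed

lemma forward_solution_continuous_on:
  assumes "forward_solution M p x"
  shows "continuous_on {0..} (\<lambda>t. x t $ z)"
  using forward_solution_component[OF assms] by (force intro!: DERIV_continuous_on)

text \<open>The equation is autonomous, so a solution can be restarted at any time; this reduces
  bounds at late times to bounds on a fixed time window.\<close>

lemma forward_solution_shift:
  assumes "forward_solution M p x" "0 \<le> s"
  shows "forward_solution M (x s) (\<lambda>r. x (s + r))"
  unfolding forward_solution_def
proof (intro conjI allI impI)
  fix t :: real assume t: "0 \<le> t"
  have "(x has_vector_derivative (transpose M *v x (s + t))) (at (s + t) within {0..})"
    using assms t by (auto simp: forward_solution_def)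
  then have "(x has_vector_derivative (transpose M *v x (s + t))) (at (s + t) within (\<lambda>r. s + r) ` {0..})"
    by (rule has_vector_derivative_within_subset) (use assms in auto)
  moreover have "((\<lambda>r. s + r) has_vector_derivative 1) (at t within {0..})"
    by (auto intro!: derivative_eq_intros)
  ultimately show "((\<lambda>r. x (s + r)) has_vector_derivative (transpose M *v x (s + t))) (at t within {0..})"
    using vector_diff_chain_within[of "\<lambda>r. s + r" 1 t "{0..}" x] by (simp add: o_def)
qed simp

text \<open>Combined with preservation of nonnegativity, this yields a comparison principle: a
  domination of \<open>q\<close> by \<open>C *\<^sub>R p\<close> persists in time.\<close>

lemma forward_solution_diff:
  assumes "forward_solution M p x" "forward_solution M q y"
  shows "forward_solution M (C *\<^sub>R p - q) (\<lambda>t. C *\<^sub>R x t - y t)"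
  using assms unfolding forward_solution_def
  by (auto intro!: derivative_eq_intros simp: matrix_vector_mult_diff_distrib matrix_vector_mult_scaleR)

text \<open>After exchanging the sums, the derivative of the total mass contains the row sums of
  \<open>M\<close>, which vanish.\<close>

lemma sum_forward_solution:
  fixes M :: "real^'z^'z"
  assumes "generator M" "forward_solution M p x" "0 \<le> t"
  shows "(\<Sum>z\<in>UNIV. x t $ z) = (\<Sum>z\<in>UNIV. p $ z)"
proof -
  have 0: "(\<Sum>z\<in>UNIV. \<Sum>w\<in>UNIV. M $ w $ z * x s $ w) = 0" for s
  proof -
    have "(\<Sum>z\<in>UNIV. \<Sum>w\<in>UNIV. M $ w $ z * x s $ w) = (\<Sum>w\<in>UNIV. (\<Sum>z\<in>UNIV. M $ w $ z) * x s $ w)"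
      by (subst sum.swap) (simp add: sum_distrib_right)
    then show ?thesis using assms(1) by (simp add: generator_def)
  qed
  have "((\<lambda>t. \<Sum>z\<in>UNIV. x t $ z) has_real_derivative 0) (at s within {0..})" if "0 \<le> s" for s
    by (subst 0[of s, symmetric]) (intro DERIV_sum forward_solution_component[OF assms(2) that])
  then have "\<exists>c. \<forall>s\<in>{0..}. (\<Sum>z\<in>UNIV. x s $ z) = c"
    by (intro has_field_derivative_zero_constant) auto
  then have "(\<Sum>z\<in>UNIV. x t $ z) = (\<Sum>z\<in>UNIV. x 0 $ z)" using assms(3) by force
  then show ?thesis using assms(2) by (simp add: forward_solution_def)
qed

text \<open>Squaring removes the kink of the negative part: at 0 the difference quotient is at most
  \<open>\<bar>h\<bar>\<close> in absolute value.\<close>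

lemma DERIV_neg_part_square: "((\<lambda>x::real. (min x 0)\<^sup>2) has_real_derivative 2 * min x 0) (at x)"
proof (cases x "0::real" rule: linorder_cases)
  case less
  have "((\<lambda>x::real. x\<^sup>2) has_real_derivative 2 * min x 0) (at x)"
    using less by (auto intro!: derivative_eq_intros)
  then show ?thesis
    by (rule has_field_derivative_transform_within_open[where S = "{..<0}"]) (use less in auto)
next
  case greater
  have "((\<lambda>x::real. 0) has_real_derivative 2 * min x 0) (at x)"
    using greater by (auto intro!: derivative_eq_intros)
  then show ?thesis
    by (rule has_field_derivative_transform_within_open[where S = "{0<..}"]) (use greater in auto)
next
  case equal
  have "((\<lambda>h::real. (min h 0)\<^sup>2 / h) \<longlongrightarrow> 0) (at 0)"
  proof (rule Lim_null_comparison)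
    show "\<forall>\<^sub>F h in at 0. norm ((min h 0)\<^sup>2 / h) \<le> \<bar>h::real\<bar>"
      by (intro always_eventually) (auto simp: min_def power2_eq_square)
    show "(abs \<longlongrightarrow> 0) (at (0::real))"
      using tendsto_rabs_zero[OF tendsto_ident_at] by simp
  qed
  then show ?thesis using equal by (simp add: DERIV_def)
qed

text \<open>Gronwall's inequality for the squared norm of the negative part.\<close>

lemma forward_solution_nonneg:
  fixes M :: "real^'z^'z"
  assumes "generator M" "forward_solution M p x" "\<And>z. 0 \<le> p $ z" "0 \<le> t"
  shows "0 \<le> x t $ z"
proof -
  define a where "a s z = min (x s $ z) 0" for s z
  define N where "N s = (\<Sum>z\<in>UNIV. (a s z)\<^sup>2)" for s
  define N' where "N' s = (\<Sum>z\<in>UNIV. 2 * a s z * (\<Sum>w\<in>UNIV. M $ w $ z * x s $ w))" for s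
  define K where "K = 2 * (\<Sum>z\<in>UNIV. \<Sum>w\<in>UNIV. \<bar>M $ w $ z\<bar>)"
  have aN: "\<bar>a s z * a s w\<bar> \<le> N s" for s z w
  proof -
    have z: "(a s z)\<^sup>2 \<le> N s" for z unfolding N_def by (rule member_le_sum) auto
    have "\<bar>a s z * a s w\<bar> \<le> ((a s z)\<^sup>2 + (a s w)\<^sup>2) / 2"
      using zero_le_power2[of "\<bar>a s z\<bar> - \<bar>a s w\<bar>"] by (simp add: power2_diff abs_mult)
    also have "\<dots> \<le> (N s + N s) / 2" by (intro divide_right_mono add_mono z) auto
    finally show ?thesis by simp
  qed
  have entry: "a s z * (M $ w $ z * x s $ w) \<le> \<bar>M $ w $ z\<bar> * N s" for s z w
  proof -
    \<comment> \<open>Off the diagonal the rate is nonnegative and \<open>a s z\<close> is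
      nonpositive, so replacing \<open>x s $ w\<close> by its negative part can only increase the
      product. On the diagonal both sides agree.\<close>
    have "a s z * (M $ w $ z * x s $ w) \<le> a s z * (M $ w $ z * a s w)"
    proof (cases "w = z")
      case True
      then show ?thesis by (auto simp: a_def min_def)
    next
      case False
      then have "0 \<le> M $ w $ z" using assms(1) by (simp add: generator_def)
      then have "M $ w $ z * a s w \<le> M $ w $ z * x s $ w"
        by (intro mult_left_mono) (auto simp: a_def)
      moreover have "a s z \<le> 0" by (simp add: a_def)
      ultimately show ?thesis by (rule mult_left_mono_neg)
    qed
    also have "\<dots> = M $ w $ z * (a s z * a s w)" by simp
    also have "\<dots> \<le> \<bar>M $ w $ z\<bar> * \<bar>a s z * a s w\<bar>" by (metis abs_ge_self abs_mult)
    also have "\<dots> \<le> \<bar>M $ w $ z\<bar> * N s" using aN[of s z w] by (intro mult_left_mono) auto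
    finally show ?thesis .
  qed
  have N'_le: "N' s \<le> K * N s" for s
  proof -
    have "N' s = 2 * (\<Sum>z\<in>UNIV. \<Sum>w\<in>UNIV. a s z * (M $ w $ z * x s $ w))"
      unfolding N'_def sum_distrib_left by (simp add: mult.assoc)
    also have "\<dots> \<le> 2 * (\<Sum>z\<in>UNIV. \<Sum>w\<in>UNIV. \<bar>M $ w $ z\<bar> * N s)"
      by (intro mult_left_mono sum_mono entry) auto
    also have "\<dots> = K * N s" by (simp add: K_def sum_distrib_right)
    finally show ?thesis .
  qed
  have N_deriv: "(N has_real_derivative N' s) (at s)" if "0 < s" for s
    unfolding N_def N'_def a_def
    by (intro DERIV_sum DERIV_chain2[OF DERIV_neg_part_square] forward_solution_DERIV[OF assms(2) that])
  have "exp (- K * t) * N t \<le> exp (- K * 0) * N 0"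
  proof (rule DERIV_nonpos_imp_decreasing_open[OF assms(4)])
    fix s assume s: "0 < s" "s < t"
    have "((\<lambda>s. exp (- K * s) * N s) has_real_derivative exp (- K * s) * (N' s - K * N s)) (at s)"
      by (auto intro!: derivative_eq_intros N_deriv[OF s(1)] simp: algebra_simps)
    then show "\<exists>y. ((\<lambda>s. exp (- K * s) * N s) has_real_derivative y) (at s) \<and> y \<le> 0"
      using N'_le[of s] by (intro exI conjI) (auto simp: mult_le_0_iff)
  next
    have cont: "continuous_on {0..t} (\<lambda>s. x s $ z)" for z
      using forward_solution_continuous_on[OF assms(2)] by (rule continuous_on_subset) auto
    show "continuous_on {0..t} (\<lambda>s. exp (- K * s) * N s)"
      unfolding N_def a_def
      by (intro continuous_on_mult continuous_on_exp continuous_on_sum continuous_on_power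
          continuous_on_min continuous_on_const continuous_on_id cont)
  qed
  moreover have "N 0 = 0"
    using assms(2,3) by (simp add: N_def a_def forward_solution_def)
  moreover have "0 \<le> N t" by (simp add: N_def sum_nonneg)
  ultimately have "N t = 0" by (simp add: mult_le_0_iff)
  then have "a t z = 0" by (simp add: N_def sum_nonneg_eq_0_iff)
  then show ?thesis by (simp add: a_def min_def split: if_splits)
qed

lemma forward_solution_prob_vecs:
  assumes "generator M" "forward_solution M p x" "p \<in> prob_vecs" "0 \<le> t"
  shows "x t \<in> prob_vecs"
  using forward_solution_nonneg[OF assms(1,2) _ assms(4)] sum_forward_solution[OF assms(1,2,4)] assms(3)
  by (auto simp: prob_vecs_def)

section \<open>Quantitative positivity by transport of mass along paths\<close>

text \<open>The factor \<open>exp (K * r)\<close> compensates the outflow from \<open>z\<close>,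
  whose rate is at most \<open>K\<close>, so the weighted mass grows at least at the inflow rate
  \<open>b\<close>. With \<open>b = 0\<close> this limits the loss of mass at a state; with positive
  \<open>b\<close> it measures the gain from a neighbour.\<close>

lemma forward_solution_exp_mono:
  fixes M :: "real^'z^'z"
  assumes "generator M" "forward_solution M p x" "\<And>z. 0 \<le> p $ z" "0 \<le> s" "s \<le> t"
    and inflow: "\<And>r. s < r \<Longrightarrow> r < t \<Longrightarrow> b \<le> (\<Sum>w\<in>UNIV - {z}. M $ w $ z * x r $ w)" and "0 \<le> b"
    and K: "\<bar>M $ z $ z\<bar> \<le> K"
  shows "exp (K * s) * x s $ z + b * (t - s) \<le> exp (K * t) * x t $ z"
proof -
  have K0: "0 \<le> K" using K by linarith
  have "exp (K * s) * x s $ z - b * s \<le> exp (K * t) * x t $ z - b * t"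
  proof (rule DERIV_nonneg_imp_increasing_open[OF assms(5)])
    fix r assume r: "s < r" "r < t"
    have r0: "0 < r" using r assms(4) by simp
    define S where "S = (\<Sum>w\<in>UNIV. M $ w $ z * x r $ w)"
    have nn: "0 \<le> x r $ w" for w
      using forward_solution_nonneg[OF assms(1-3)] r0 by simp
    have "S = M $ z $ z * x r $ z + (\<Sum>w\<in>UNIV-{z}. M $ w $ z * x r $ w)"
      unfolding S_def by (rule sum.remove) auto
    moreover have "- K * x r $ z \<le> M $ z $ z * x r $ z"
      using K by (intro mult_right_mono nn) auto
    ultimately have S: "b \<le> S + K * x r $ z" using inflow[OF r] by linarith
    have "1 \<le> exp (K * r)" using K0 r0 by simp
    then have "b \<le> exp (K * r) * b" using \<open>0 \<le> b\<close> by (simp add: mult_le_cancel_right1)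
    also have "\<dots> \<le> exp (K * r) * (S + K * x r $ z)" using S by simp
    finally have "0 \<le> exp (K * r) * (S + K * x r $ z) - b" by simp
    moreover have "((\<lambda>r. exp (K * r) * x r $ z - b * r) has_real_derivative
        exp (K * r) * (S + K * x r $ z) - b) (at r)"
      unfolding S_def
      by (auto intro!: derivative_eq_intros forward_solution_DERIV[OF assms(2) r0] simp: algebra_simps)
    ultimately show "\<exists>y. ((\<lambda>r. exp (K * r) * x r $ z - b * r) has_real_derivative y) (at r) \<and> 0 \<le> y"
      by blast
  next
    have "continuous_on {s..t} (\<lambda>s. x s $ z)"
      using forward_solution_continuous_on[OF assms(2)] by (rule continuous_on_subset) (use assms in auto)
    then show "continuous_on {s..t} (\<lambda>r. exp (K * r) * x r $ z - b * r)"
      by (auto intro!: continuous_intros)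
  qed
  then show ?thesis by (simp add: algebra_simps)
qed

text \<open>Induction along the path from \<open>v\<close>. For each edge, the previous state is
  already charged at time \<open>a / 2\<close>, and the remaining waiting time fills the next state;
  this halving is why \<open>a\<close> is generalised. The right end 1 of the window bounds the loss
  factor by \<open>exp (- K)\<close>.\<close>

lemma forward_solution_path_lower_bound:
  fixes M :: "real^'z^'z"
  assumes "generator M" "(v, z) \<in> {(x, y). 0 < M $ x $ y}\<^sup>*" "0 < e" "0 < a"
  shows "\<exists>c>0. \<forall>p x. forward_solution M p x \<longrightarrow> p \<in> prob_vecs \<longrightarrow> e \<le> p $ v \<longrightarrow>
    (\<forall>r\<in>{a..1}. c \<le> x r $ z)"
  using assms(2,4)
proof (induction arbitrary: a rule: rtrancl_induct)
  case base
  define K where "K = \<bar>M $ v $ v\<bar>"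
  show ?case
  proof (intro exI[of _ "exp (- K) * e"] conjI allI impI ballI)
    show "0 < exp (- K) * e" using assms(3) by simp
    fix p x r assume x: "forward_solution M p x" "p \<in> prob_vecs" "e \<le> p $ v" and r: "r \<in> {a..1}"
    have p: "0 \<le> p $ z" for z using x by (auto simp: prob_vecs_def)
    have nn: "0 \<le> x s $ w" if "0 \<le> s" for w s
      using forward_solution_nonneg[OF assms(1) x(1) p that] .
    have "exp (K * 0) * x 0 $ v + 0 * (r - 0) \<le> exp (K * r) * x r $ v"
      using assms(1) base r
      by (intro forward_solution_exp_mono[OF assms(1) x(1) p] sum_nonneg mult_nonneg_nonneg nn)
         (auto simp: generator_def K_def)
    then have "e \<le> exp (K * r) * x r $ v" using x by (simp add: forward_solution_def)
    also have "\<dots> \<le> exp K * x r $ v"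
      using r base nn[of r v] by (intro mult_right_mono) (auto simp: K_def mult_left_le)
    finally show "exp (- K) * e \<le> x r $ v" by (simp add: exp_minus field_simps)
  qed
next
  case (step y z)
  have yz: "0 < M $ y $ z" using step.hyps by simp
  show ?case
  proof (cases "y = z")
    case True
    then show ?thesis using step.IH[OF step.prems] by simp
  next
    case False
    obtain c where c: "0 < c" and lower: "\<And>p x r. forward_solution M p x \<Longrightarrow> p \<in> prob_vecs \<Longrightarrow>
        e \<le> p $ v \<Longrightarrow> a / 2 \<le> r \<Longrightarrow> r \<le> 1 \<Longrightarrow> c \<le> x r $ y"
      using step.IH[of "a / 2"] step.prems by auto
    define K where "K = \<bar>M $ z $ z\<bar>"
    define b where "b = M $ y $ z * c"
    have b: "0 < b" using c yz by (simp add: b_def)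
    show ?thesis
    \<comment> \<open>Mass arrives at rate at least \<open>b\<close> for at least
      \<open>a / 2\<close> units of time and is lost at rate at most \<open>K\<close> up to time
      1.\<close>
    proof (intro exI[of _ "exp (- K) * (b * (a / 2))"] conjI allI impI ballI)
      show "0 < exp (- K) * (b * (a / 2))" using b step.prems by simp
      fix p x r assume x: "forward_solution M p x" "p \<in> prob_vecs" "e \<le> p $ v" and r: "r \<in> {a..1}"
      have p: "0 \<le> p $ z" for z using x by (auto simp: prob_vecs_def)
      have nn: "0 \<le> x s $ w" if "0 \<le> s" for w s
        using forward_solution_nonneg[OF assms(1) x(1) p that] .
      have inflow: "b \<le> (\<Sum>w\<in>UNIV - {z}. M $ w $ z * x s $ w)" if s: "a / 2 < s" "s < r" for s
      proof -
        have s0: "0 \<le> s" using s step.prems by linarith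
        have "b \<le> M $ y $ z * x s $ y"
          unfolding b_def using lower[OF x, of s] s r yz by (intro mult_left_mono) auto
        also have "\<dots> \<le> (\<Sum>w\<in>UNIV - {z}. M $ w $ z * x s $ w)"
          using False assms(1) nn[OF s0]
          by (intro member_le_sum) (auto simp: generator_def)
        finally show ?thesis .
      qed
      have "0 \<le> exp (K * (a / 2)) * x (a / 2) $ z" using nn step.prems by simp
      moreover have "exp (K * (a / 2)) * x (a / 2) $ z + b * (r - a / 2) \<le> exp (K * r) * x r $ z"
        using r step.prems b
        by (intro forward_solution_exp_mono[OF assms(1) x(1) p] inflow) (auto simp: K_def)
      moreover have "b * (a / 2) \<le> b * (r - a / 2)"
        using r b by (intro mult_left_mono) auto
      ultimately have "b * (a / 2) \<le> exp (K * r) * x r $ z" by linarith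
      also have "\<dots> \<le> exp K * x r $ z"
        using r step.prems nn[of r z] by (intro mult_right_mono) (auto simp: K_def mult_left_le)
      finally show "exp (- K) * (b * (a / 2)) \<le> x r $ z" by (simp add: exp_minus field_simps)
    qed
  qed
qed

text \<open>Every probability vector has an entry of at least \<open>1 / CARD('z)\<close>.
  Restarting at time \<open>t - a\<close> from such an entry, the path bound applies after a delay
  of exactly \<open>a\<close>; minimising over the finitely many pairs of states gives a constant
  free of the solution and of \<open>t\<close>.\<close>

lemma forward_solution_uniform_lower_bound:
  fixes M :: "real^'z^'z"
  assumes "generator M" "irreducible_gen M" "0 < a" "a \<le> 1"
  shows "\<exists>c>0. \<forall>p x t z. forward_solution M p x \<longrightarrow> p \<in> prob_vecs \<longrightarrow> a \<le> t \<longrightarrow> c \<le> x t $ z"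
proof -
  define e :: real where "e = 1 / CARD('z)"
  have e: "0 < e" by (simp add: e_def)
  have "\<forall>v z. \<exists>c>0. \<forall>p x. forward_solution M p x \<longrightarrow> p \<in> prob_vecs \<longrightarrow> e \<le> p $ v \<longrightarrow>
      (\<forall>r\<in>{a..1}. c \<le> x r $ z)"
    using forward_solution_path_lower_bound[OF assms(1) _ e assms(3)] assms(2)
    by (auto simp: irreducible_gen_def)
  then obtain c where c: "\<And>v z. 0 < c v z" and lower: "\<And>v z p x r. forward_solution M p x \<Longrightarrow>
      p \<in> prob_vecs \<Longrightarrow> e \<le> p $ v \<Longrightarrow> r \<in> {a..1} \<Longrightarrow> c v z \<le> x r $ z"
    by metis
  define C where "C = Min (range (\<lambda>(v, z). c v z))"
  have C0: "0 < C" unfolding C_def using c by (subst Min_gr_iff) auto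
  have C: "C \<le> c v z" for v z unfolding C_def by (rule Min_le) auto
  have "C \<le> x t $ z" if x: "forward_solution M p x" "p \<in> prob_vecs" and t: "a \<le> t" for p x t z
  proof -
    have ta: "0 \<le> t - a" using t by simp
    have pv: "x (t - a) \<in> prob_vecs" using forward_solution_prob_vecs[OF assms(1) x ta] .
    have "\<exists>v. e \<le> x (t - a) $ v"
    proof (rule ccontr)
      assume "\<nexists>v. e \<le> x (t - a) $ v"
      then have "(\<Sum>v\<in>UNIV. x (t - a) $ v) < (\<Sum>v\<in>(UNIV::'z set). e)"
        by (intro sum_strict_mono) (auto simp: not_le)
      then show False using pv by (simp add: prob_vecs_def e_def)
    qed
    then obtain v where "e \<le> x (t - a) $ v" by blast
    then have "c v z \<le> x (t - a + a) $ z"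
      by (rule lower[OF forward_solution_shift[OF x(1) ta] pv]) (use assms(4) in auto)
    then show ?thesis using C[of v z] by simp
  qed
  then show ?thesis using C0 by blast
qed

subsection \<open>Divergences along pairs of solutions\<close>

text \<open>The Csiszar divergence attached to \<open>h\<close>. Variance and entropy are the cases
  \<open>(x - 1)\<^sup>2\<close> and \<open>x * ln x\<close>, so they share one derivative formula
  and one limit at time 0.\<close>

definition fdiv :: "(real \<Rightarrow> real) \<Rightarrow> real^'z \<Rightarrow> real^'z \<Rightarrow> real" where
  "fdiv h \<zeta> \<mu> = (\<Sum>z\<in>UNIV. \<zeta> $ z * h (\<mu> $ z / \<zeta> $ z))"

text \<open>Because the rows of \<open>M\<close> sum to \<open>0\<close>, the terms \<open>h (\<phi> w)\<close> can be inserted for free,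
  which turns the derivative into a sum of Bregman divergences.\<close>

lemma fdiv_DERIV:
  fixes M :: "real^'z^'z"
  assumes "generator M" "forward_solution M p \<zeta>" "forward_solution M q \<mu>" "0 < t"
    and pos: "\<And>z. 0 < \<zeta> t $ z" "\<And>z. 0 < \<mu> t $ z"
    and h: "\<And>x. 0 < x \<Longrightarrow> (h has_real_derivative h' x) (at x)"
  defines "\<phi> \<equiv> \<lambda>z. \<mu> t $ z / \<zeta> t $ z"
  shows "((\<lambda>t. fdiv h (\<zeta> t) (\<mu> t)) has_real_derivative
    - (\<Sum>w\<in>UNIV. \<Sum>z\<in>UNIV. M $ w $ z * \<zeta> t $ w * (h (\<phi> w) - h (\<phi> z) - h' (\<phi> z) * (\<phi> w - \<phi> z)))) (at t)"
proof -
  define A where "A z = (\<Sum>w\<in>UNIV. M $ w $ z * \<zeta> t $ w)" for z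
  define B where "B z = (\<Sum>w\<in>UNIV. M $ w $ z * \<mu> t $ w)" for z
  have nz: "\<zeta> t $ z \<noteq> 0" for z using pos(1)[of z] by simp
  have dq: "((\<lambda>t. \<mu> t $ z / \<zeta> t $ z) has_real_derivative (B z - \<phi> z * A z) / \<zeta> t $ z) (at t)" for z
    by (rule derivative_eq_intros forward_solution_DERIV[OF assms(2,4)]
        forward_solution_DERIV[OF assms(3,4)] nz)+
       (use nz[of z] in \<open>simp add: A_def B_def \<phi>_def field_simps\<close>)
  have dh: "((\<lambda>t. h (\<mu> t $ z / \<zeta> t $ z)) has_real_derivative h' (\<phi> z) * ((B z - \<phi> z * A z) / \<zeta> t $ z)) (at t)" for z
    by (rule DERIV_chain2[OF _ dq]) (use h pos in \<open>simp add: \<phi>_def\<close>)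
  have "((\<lambda>t. fdiv h (\<zeta> t) (\<mu> t)) has_real_derivative
      (\<Sum>z\<in>UNIV. A z * h (\<phi> z) + h' (\<phi> z) * (B z - \<phi> z * A z))) (at t)"
    unfolding fdiv_def
  proof (rule DERIV_sum)
    fix z
    show "((\<lambda>t. \<zeta> t $ z * h (\<mu> t $ z / \<zeta> t $ z)) has_real_derivative
        A z * h (\<phi> z) + h' (\<phi> z) * (B z - \<phi> z * A z)) (at t)"
      by (rule DERIV_cong[OF DERIV_mult[OF forward_solution_DERIV[OF assms(2,4)] dh]])
         (use nz[of z] in \<open>simp add: A_def \<phi>_def\<close>)
  qed
  also have "(\<Sum>z\<in>UNIV. A z * h (\<phi> z) + h' (\<phi> z) * (B z - \<phi> z * A z)) =
      (\<Sum>z\<in>UNIV. \<Sum>w\<in>UNIV. M $ w $ z * \<zeta> t $ w * (h (\<phi> z) + h' (\<phi> z) * (\<phi> w - \<phi> z)))"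
  proof (rule sum.cong[OF refl])
    fix z
    \<comment> \<open>Writing \<mu> as \<zeta> times the ratio puts both inflows on the common
      weights \<open>M $ w $ z * \<zeta> t $ w\<close>.\<close>
    have "B z = (\<Sum>w\<in>UNIV. M $ w $ z * \<zeta> t $ w * \<phi> w)"
      unfolding B_def by (intro sum.cong) (use nz in \<open>auto simp: \<phi>_def\<close>)
    then show "A z * h (\<phi> z) + h' (\<phi> z) * (B z - \<phi> z * A z) =
        (\<Sum>w\<in>UNIV. M $ w $ z * \<zeta> t $ w * (h (\<phi> z) + h' (\<phi> z) * (\<phi> w - \<phi> z)))"
      by (simp add: A_def sum_distrib_left sum_distrib_right sum_subtractf[symmetric]
          sum.distrib[symmetric] algebra_simps)
  qed
  also have "\<dots> = (\<Sum>w\<in>UNIV. \<Sum>z\<in>UNIV. M $ w $ z * \<zeta> t $ w * (h (\<phi> z) + h' (\<phi> z) * (\<phi> w - \<phi> z)))"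
    by (rule sum.swap)
  also have "\<dots> = (\<Sum>w\<in>UNIV. \<Sum>z\<in>UNIV. M $ w $ z * \<zeta> t $ w * (h (\<phi> z) + h' (\<phi> z) * (\<phi> w - \<phi> z)))
      - (\<Sum>w\<in>UNIV. (\<Sum>z\<in>UNIV. M $ w $ z) * (\<zeta> t $ w * h (\<phi> w)))"
    using assms(1) by (simp add: generator_def)
  also have "\<dots> = - (\<Sum>w\<in>UNIV. \<Sum>z\<in>UNIV. M $ w $ z * \<zeta> t $ w * (h (\<phi> w) - h (\<phi> z) - h' (\<phi> z) * (\<phi> w - \<phi> z)))"
    unfolding sum_distrib_right sum_subtractf[symmetric] sum_negf[symmetric]
    by (intro sum.cong refl) (simp add: algebra_simps)
  finally show ?thesis .
qed

text \<open>Where \<open>p $ z\<close> is positive, the ratio itself converges. Where it vanishes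
  the ratio may have no limit, but it stays bounded while its weight \<open>\<zeta> t $ z\<close>
  tends to 0.\<close>

lemma tendsto_fdiv_0:
  fixes M :: "real^'z^'z"
  assumes "generator M" "forward_solution M p \<zeta>" "forward_solution M q \<mu>"
    and "p \<in> prob_vecs" "q \<in> prob_vecs" "abs_cont q p"
    and pos: "\<And>t z. 0 < t \<Longrightarrow> 0 < \<zeta> t $ z"
    and h: "continuous_on {0..} h"
  shows "((\<lambda>t. fdiv h (\<zeta> t) (\<mu> t)) \<longlongrightarrow> fdiv h p q) (at_right 0)"
  unfolding fdiv_def
proof (rule tendsto_sum)
  fix z
  have lim: "((\<lambda>t. x t $ z) \<longlongrightarrow> r $ z) (at_right 0)" if "forward_solution M r x" for r x
  proof -
    have "((\<lambda>t. x t $ z) \<longlongrightarrow> x 0 $ z) (at 0 within {0..})"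
      using forward_solution_continuous_on[OF that, of z] by (auto simp: continuous_on_def)
    then show ?thesis
      using that by (auto simp: forward_solution_def intro: tendsto_within_subset)
  qed
  have p: "0 \<le> p $ z" and q: "0 \<le> q $ z" for z using assms(4,5) by (auto simp: prob_vecs_def)
  have mu: "0 \<le> \<mu> t $ z" if "0 < t" for t
    using forward_solution_nonneg[OF assms(1,3) q] that by simp
  have ev: "\<forall>\<^sub>F t in at_right (0::real). 0 < t" by (rule eventually_at_right_less)
  show "((\<lambda>t. \<zeta> t $ z * h (\<mu> t $ z / \<zeta> t $ z)) \<longlongrightarrow> p $ z * h (q $ z / p $ z)) (at_right 0)"
  proof (cases "p $ z = 0")
    case False
    have "((\<lambda>t. h (\<mu> t $ z / \<zeta> t $ z)) \<longlongrightarrow> h (q $ z / p $ z)) (at_right 0)"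
    proof (rule continuous_on_tendsto_compose[OF h])
      show "((\<lambda>t. \<mu> t $ z / \<zeta> t $ z) \<longlongrightarrow> q $ z / p $ z) (at_right 0)"
        by (intro tendsto_divide lim assms False)
      show "q $ z / p $ z \<in> {0..}" using p q by simp
      show "\<forall>\<^sub>F t in at_right 0. \<mu> t $ z / \<zeta> t $ z \<in> {0..}"
        using ev by eventually_elim (use mu pos in \<open>simp add: less_imp_le\<close>)
    qed
    then show ?thesis by (intro tendsto_mult lim assms)
  next
    case True
    \<comment> \<open>\<open>C\<close> dominates every initial ratio; states with
      \<open>p $ z = 0\<close> add 0, the value of division by zero. Hence
      \<open>C *\<^sub>R p - q\<close> is nonnegative, and it remains so along the flow.\<close>
    define C where "C = (\<Sum>z\<in>UNIV. q $ z / p $ z)"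
    have C0: "0 \<le> C" using p q by (simp add: C_def sum_nonneg)
    have Cq: "0 \<le> (C *\<^sub>R p - q) $ z" for z
    proof (cases "p $ z = 0")
      case True
      then show ?thesis using assms(6) by (simp add: abs_cont_def)
    next
      case False
      have "q $ z / p $ z \<le> C"
        unfolding C_def using p q by (intro member_le_sum) auto
      then show ?thesis using False p[of z] by (simp add: field_simps)
    qed
    have ratio: "\<mu> t $ z / \<zeta> t $ z \<in> {0..C}" if "0 < t" for t
      using forward_solution_nonneg[OF assms(1) forward_solution_diff[OF assms(2,3)] Cq, of t z]
        pos[OF that, of z] mu[OF that] that by (simp add: field_simps)
    have "bounded (h ` {0..C})"
      by (intro compact_imp_bounded compact_continuous_image continuous_on_subset[OF h]) auto
    then obtain b where b: "\<forall>x\<in>{0..C}. \<bar>h x\<bar> \<le> b"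
      by (auto simp: bounded_iff)
    have "((\<lambda>t. \<zeta> t $ z * h (\<mu> t $ z / \<zeta> t $ z)) \<longlongrightarrow> 0) (at_right 0)"
    proof (rule Lim_null_comparison)
      show "\<forall>\<^sub>F t in at_right 0. norm (\<zeta> t $ z * h (\<mu> t $ z / \<zeta> t $ z)) \<le> \<zeta> t $ z * b"
        using ev by eventually_elim
          (use b ratio pos in \<open>auto simp: abs_mult less_imp_le intro!: mult_mono\<close>)
      show "((\<lambda>t. \<zeta> t $ z * b) \<longlongrightarrow> 0) (at_right 0)"
        using tendsto_mult_right[OF lim[OF assms(2)], of b] True by simp
    qed
    then show ?thesis using True by simp
  qed
qed

text \<open>Only the limit at \<open>0\<close> is available, since the ratio \<open>\<mu> / \<zeta>\<close> need not extend continuously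
  to \<open>t = 0\<close>.\<close>

lemma exp_decay_from_limit:
  fixes F I :: "real \<Rightarrow> real"
  assumes lim: "(F \<longlongrightarrow> F0) (at_right 0)"
    and deriv: "\<And>t. 0 < t \<Longrightarrow> (F has_real_derivative - I t) (at t)"
    and I: "\<And>t. 0 < t \<Longrightarrow> 0 \<le> I t" "\<And>t. \<delta> \<le> t \<Longrightarrow> \<alpha> * F t \<le> I t"
    and "0 < \<delta>" "0 < \<alpha>" "0 < t"
  shows "F t \<le> F0 * min 1 (exp (- \<alpha> * (t - \<delta>)))"
proof -
  have anti: "F t \<le> F s" if "0 < s" "s \<le> t" for s t
  proof (rule DERIV_nonpos_imp_nonincreasing[OF that(2)])
    fix x assume "s \<le> x" "x \<le> t"
    then have "0 < x" using that by linarith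
    then show "\<exists>y. (F has_real_derivative y) (at x) \<and> y \<le> 0"
      using deriv I(1) by (intro exI[of _ "- I x"]) auto
  qed
  have le0: "F t \<le> F0" if "0 < t" for t
  proof (rule tendsto_lowerbound[OF lim])
    show "\<forall>\<^sub>F s in at_right 0. F t \<le> F s"
      using eventually_at_right_real[OF that] by eventually_elim (auto intro: anti)
  qed simp
  show ?thesis
  proof (cases "\<delta> \<le> t")
    case True
    \<comment> \<open>Gronwall from \<delta> on; the value at \<delta> is then replaced by the limit
      \<open>F0\<close>, which costs the shift by \<delta> in the exponent.\<close>
    have "exp (\<alpha> * t) * F t \<le> exp (\<alpha> * \<delta>) * F \<delta>"
    proof (rule DERIV_nonpos_imp_nonincreasing[OF True])
      fix x assume x: "\<delta> \<le> x" "x \<le> t"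
      then have x0: "0 < x" using assms by linarith
      have "((\<lambda>t. exp (\<alpha> * t) * F t) has_real_derivative exp (\<alpha> * x) * (\<alpha> * F x - I x)) (at x)"
        by (auto intro!: derivative_eq_intros deriv[OF x0] simp: algebra_simps)
      moreover have "exp (\<alpha> * x) * (\<alpha> * F x - I x) \<le> 0"
        using I(2)[OF x(1)] by (simp add: mult_le_0_iff)
      ultimately show "\<exists>y. ((\<lambda>t. exp (\<alpha> * t) * F t) has_real_derivative y) (at x) \<and> y \<le> 0" by blast
    qed
    also have "\<dots> \<le> exp (\<alpha> * \<delta>) * F0" using le0[OF \<open>0 < \<delta>\<close>] by simp
    finally have "F t \<le> F0 * exp (- \<alpha> * (t - \<delta>))"
      by (simp add: exp_minus exp_diff right_diff_distrib field_simps)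
    moreover have "- \<alpha> * (t - \<delta>) \<le> 0" using True assms by (simp add: mult_le_0_iff)
    ultimately show ?thesis by (simp add: min_absorb2)
  next
    case False
    \<comment> \<open>Before \<delta> the minimum equals 1, so monotonicity alone gives the
      bound.\<close>
    then have "0 \<le> - \<alpha> * (t - \<delta>)" using assms by (simp add: mult_le_0_iff)
    then show ?thesis using le0[OF assms(7)] by (simp add: min_absorb1)
  qed
qed

subsection \<open>Functional inequalities\<close>

text \<open>Apply \<open>ln y \<le> y - 1\<close> to \<open>y = sqrt x\<close> and double
  it.\<close>

lemma x_minus_1_minus_ln_ge:
  fixes x :: real
  assumes "0 < x"
  shows "(sqrt x - 1)\<^sup>2 \<le> x - 1 - ln x"
proof -
  have "ln x = 2 * ln (sqrt x)" using assms by (simp add: ln_sqrt)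
  also have "\<dots> \<le> 2 * (sqrt x - 1)" using ln_le_minus_one[of "sqrt x"] assms by simp
  finally show ?thesis using assms by (simp add: power2_diff)
qed

text \<open>Factor \<open>a - b\<close> as a difference of squares of roots. The sum of the roots
  squares to at most \<open>4 * B\<close>, and the difference squares to
  \<open>a * (sqrt (b / a) - 1)\<^sup>2\<close>, to which the root bound applies. The upper bound
  \<open>B\<close> thus buys a quadratic estimate.\<close>

lemma entropy_bregman_ge:
  fixes a b B :: real
  assumes "0 < a" "0 < b" "a \<le> B" "b \<le> B"
  shows "(a - b)\<^sup>2 / (4 * B) \<le> a * (b / a - 1 - ln (b / a))"
proof -
  have B: "0 < B" using assms by linarith
  have "(a - b)\<^sup>2 = ((sqrt b + sqrt a) * (sqrt b - sqrt a))\<^sup>2"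
    using assms by (simp add: algebra_simps power2_commute)
  also have "\<dots> = (sqrt b + sqrt a)\<^sup>2 * (sqrt b - sqrt a)\<^sup>2" by (rule power_mult_distrib)
  also have "\<dots> \<le> (4 * B) * (sqrt b - sqrt a)\<^sup>2"
  proof (rule mult_right_mono)
    have "(sqrt b + sqrt a)\<^sup>2 \<le> (2 * sqrt B)\<^sup>2"
      using assms real_sqrt_le_mono[of a B] real_sqrt_le_mono[of b B]
      by (intro power_mono) (linarith, simp)
    then show "(sqrt b + sqrt a)\<^sup>2 \<le> 4 * B" using B by (simp add: power_mult_distrib)
  qed simp
  finally have "(a - b)\<^sup>2 / (4 * B) \<le> (sqrt b - sqrt a)\<^sup>2" using B by (simp add: field_simps)
  also have "\<dots> = a * (sqrt (b / a) - 1)\<^sup>2"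
  proof -
    have "sqrt b - sqrt a = sqrt a * (sqrt (b / a) - 1)"
      using assms by (simp add: real_sqrt_divide field_simps)
    then show ?thesis using assms by (simp add: power_mult_distrib)
  qed
  also have "\<dots> \<le> a * (b / a - 1 - ln (b / a))"
    using x_minus_1_minus_ln_ge[of "b / a"] assms by (intro mult_left_mono) auto
  finally show ?thesis .
qed

text \<open>The root bound at \<open>1 / x\<close>, multiplied by \<open>x\<close>. It shows that
  the integrand is positive away from 1.\<close>

lemma entropy_integrand_ge:
  fixes x :: real
  assumes "0 < x"
  shows "(sqrt x - 1)\<^sup>2 \<le> x * ln x - x + 1"
proof -
  have "(sqrt x - 1)\<^sup>2 = x * (sqrt (1 / x) - 1)\<^sup>2"
  proof -
    have "sqrt x * (sqrt (1 / x) - 1) = 1 - sqrt x"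
      using assms by (simp add: real_sqrt_divide field_simps)
    then have "(1 - sqrt x)\<^sup>2 = (sqrt x)\<^sup>2 * (sqrt (1 / x) - 1)\<^sup>2"
      by (metis power_mult_distrib)
    then show ?thesis using assms by (simp add: power2_commute)
  qed
  also have "\<dots> \<le> x * (1 / x - 1 - ln (1 / x))"
    using x_minus_1_minus_ln_ge[of "1 / x"] assms by (intro mult_left_mono) auto
  also have "\<dots> = x * ln x - x + 1" using assms by (simp add: ln_div field_simps)
  finally show ?thesis .
qed

text \<open>The added terms cancel because \<zeta> and its product with \<phi> both have mass 1;
  afterwards every single summand is nonnegative.\<close>

lemma entropy_alt:
  assumes "\<zeta> \<in> prob_vecs" "\<phi> \<in> densities \<zeta>"
  shows "entropy \<zeta> \<phi> = (\<Sum>z\<in>UNIV. (\<phi> $ z * ln (\<phi> $ z) - \<phi> $ z + 1) * \<zeta> $ z)"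
  using assms by (simp add: entropy_def densities_def expect_def prob_vecs_def algebra_simps
      sum.distrib sum_subtractf)

lemma entropy_pos:
  assumes "\<zeta> \<in> prob_vecs" "\<And>z. 0 < \<zeta> $ z" "\<phi> \<in> densities \<zeta>" "\<phi> \<noteq> 1"
  shows "0 < entropy \<zeta> \<phi>"
proof -
  have pos: "0 < \<phi> $ z" for z using assms by (simp add: densities_def)
  obtain z where z: "\<phi> $ z \<noteq> 1" using assms(4) by (auto simp: vec_eq_iff)
  show ?thesis
    unfolding entropy_alt[OF assms(1,3)]
  proof (rule sum_pos2[of _ z])
    have "0 < (sqrt (\<phi> $ z) - 1)\<^sup>2" using z by simp
    then show "0 < (\<phi> $ z * ln (\<phi> $ z) - \<phi> $ z + 1) * \<zeta> $ z"
      using entropy_integrand_ge[OF pos[of z]] assms(2)[of z]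
      by (intro mult_pos_pos) linarith+
    fix w
    have "0 \<le> (sqrt (\<phi> $ w) - 1)\<^sup>2" by simp
    then show "0 \<le> (\<phi> $ w * ln (\<phi> $ w) - \<phi> $ w + 1) * \<zeta> $ w"
      using entropy_integrand_ge[OF pos[of w]] assms(2)[of w]
      by (intro mult_nonneg_nonneg) (linarith, simp)
  qed auto
qed

text \<open>Diagonal rates are nonpositive, but there the ratio is 1 and the bracket vanishes;
  elsewhere \<open>ln u \<le> u - 1\<close> applies.\<close>

lemma fisher_summand_nonneg:
  assumes "generator M" "\<And>z. 0 < \<zeta> $ z" "\<And>z. 0 < \<phi> $ z"
  shows "0 \<le> M $ w $ z * \<zeta> $ w * \<phi> $ w * (\<phi> $ z / \<phi> $ w - 1 - ln (\<phi> $ z / \<phi> $ w))"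
proof (cases "w = z")
  case True
  then show ?thesis using assms(3)[of z] by simp
next
  case False
  have "0 \<le> \<phi> $ z / \<phi> $ w - 1 - ln (\<phi> $ z / \<phi> $ w)"
    using ln_le_minus_one[of "\<phi> $ z / \<phi> $ w"] assms(3) by simp
  then show ?thesis
    using False assms by (intro mult_nonneg_nonneg) (auto simp: generator_def less_imp_le)
qed

lemma fisher_nonneg:
  assumes "generator M" "\<And>z. 0 < \<zeta> $ z" "\<And>z. 0 < \<phi> $ z"
  shows "0 \<le> fisher M \<zeta> \<phi>"
  unfolding fisher_def by (intro sum_nonneg fisher_summand_nonneg assms)

lemma dirichlet_nonneg:
  assumes "generator M" "\<And>z. 0 < \<zeta> $ z"
  shows "0 \<le> dirichlet M \<zeta> f"
proof -
  have "0 \<le> M $ z $ z' * \<zeta> $ z * (f $ z - f $ z')\<^sup>2" for z z'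
    using assms by (cases "z = z'") (auto simp: generator_def less_imp_le)
  then show ?thesis unfolding dirichlet_def by (simp add: sum_nonneg)
qed

section \<open>Uniform comparison of Fisher information and entropy\<close>

text \<open>By the triangle inequality each edge of a path adds at most \<open>d\<close>, so the
  factor for a pair is a path length, independent of \<open>f\<close>. A maximum over the finitely
  many pairs serves them all; inserting 1 makes it positive.\<close>

lemma irreducible_diff_bound:
  fixes M :: "real^'z^'z"
  assumes "irreducible_gen M"
  shows "\<exists>K>0. \<forall>(f :: 'z \<Rightarrow> real) d. 0 \<le> d \<longrightarrow> (\<forall>x y. 0 < M $ x $ y \<longrightarrow> \<bar>f x - f y\<bar> \<le> d) \<longrightarrow>
    (\<forall>x y. \<bar>f x - f y\<bar> \<le> K * d)"
proof -
  have path: "\<exists>k::real. \<forall>(f :: 'z \<Rightarrow> real) d. (\<forall>x y. 0 < M $ x $ y \<longrightarrow> \<bar>f x - f y\<bar> \<le> d) \<longrightarrow> \<bar>f x - f y\<bar> \<le> k * d"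
    if "(x, y) \<in> {(x, y). 0 < M $ x $ y}\<^sup>*" for x y
    using that
  proof (induction rule: rtrancl_induct)
    case base
    show ?case by (intro exI[of _ 0]) simp
  next
    case (step y z)
    then obtain k where k: "\<And>(f :: 'z \<Rightarrow> real) d. (\<forall>x y. 0 < M $ x $ y \<longrightarrow> \<bar>f x - f y\<bar> \<le> d) \<Longrightarrow> \<bar>f x - f y\<bar> \<le> k * d"
      by blast
    have "\<bar>f x - f z\<bar> \<le> (k + 1) * d"
      if "\<forall>x y. 0 < M $ x $ y \<longrightarrow> \<bar>f x - f y\<bar> \<le> d" for f :: "'z \<Rightarrow> real" and d
    proof -
      have "\<bar>f y - f z\<bar> \<le> d" using that step.hyps by simp
      with k[OF that] show ?thesis by (simp add: algebra_simps)
    qed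
    then show ?case by blast
  qed
  have "\<forall>x y. \<exists>k::real. \<forall>(f :: 'z \<Rightarrow> real) d. (\<forall>x y. 0 < M $ x $ y \<longrightarrow> \<bar>f x - f y\<bar> \<le> d) \<longrightarrow> \<bar>f x - f y\<bar> \<le> k * d"
    using path assms unfolding irreducible_gen_def by blast
  then obtain k :: "'z \<Rightarrow> 'z \<Rightarrow> real" where k: "\<And>x y (f :: 'z \<Rightarrow> real) d.
      (\<forall>x y. 0 < M $ x $ y \<longrightarrow> \<bar>f x - f y\<bar> \<le> d) \<Longrightarrow> \<bar>f x - f y\<bar> \<le> k x y * d"
    by metis
  define K where "K = Max (insert 1 (range (\<lambda>(x, y). k x y)))"
  have K1: "1 \<le> K" unfolding K_def by (rule Max_ge) auto
  have "k x y \<le> K" for x y unfolding K_def by (rule Max_ge) (auto intro!: insertI2 image_eqI[of _ _ "(x, y)"])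
  then have "\<bar>f x - f y\<bar> \<le> K * d"
    if "0 \<le> d" "\<forall>x y. 0 < M $ x $ y \<longrightarrow> \<bar>f x - f y\<bar> \<le> d" for f :: "'z \<Rightarrow> real" and d x y
    using k[OF that(2), of x y] mult_right_mono[OF _ that(1), of "k x y" K] by force
  then show ?thesis using K1 by (intro exI[of _ K]) auto
qed

lemma fisher_ge_entropy:
  fixes M :: "real^'z^'z"
  assumes "generator M" "irreducible_gen M" "0 < c"
  shows "\<exists>\<alpha>>0. \<forall>\<zeta>\<in>prob_vecs. (\<forall>z. c \<le> \<zeta> $ z) \<longrightarrow>
    (\<forall>\<phi>\<in>densities \<zeta>. \<alpha> * entropy \<zeta> \<phi> \<le> fisher M \<zeta> \<phi>)"
proof -
  obtain K where K: "0 < K" and diff: "\<And>(f :: 'z \<Rightarrow> real) d x y. 0 \<le> d \<Longrightarrow>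
      (\<forall>x y. 0 < M $ x $ y \<longrightarrow> \<bar>f x - f y\<bar> \<le> d) \<Longrightarrow> \<bar>f x - f y\<bar> \<le> K * d"
    using irreducible_diff_bound[OF assms(2)] by blast
  \<comment> \<open>The smallest positive rate; 1 is inserted so that the set is visibly
    nonempty.\<close>
  define m where "m = Min (insert 1 {M $ x $ y |x y. 0 < M $ x $ y})"
  have fin: "finite {M $ x $ y |x y. 0 < M $ x $ y}"
    by (rule finite_subset[of _ "range (\<lambda>(x, y). M $ x $ y)"]) auto
  have m: "0 < m" unfolding m_def using fin by (subst Min_gr_iff) auto
  have m_le: "m \<le> M $ x $ y" if "0 < M $ x $ y" for x y
    unfolding m_def using fin that by (intro Min_le) auto
  \<comment> \<open>Since \<phi> is at most \<open>1 / c\<close>, an edge difference has square at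
    most \<open>4 * fisher M \<zeta> \<phi> / (m * c * c)\<close>: one \<open>c\<close> comes from
    the weight, the other from \<open>B = 1 / c\<close>. Passing from edges to arbitrary pairs costs
    the factor \<open>K\<^sup>2\<close>.\<close>
  define \<alpha> where "\<alpha> = m * c * c / (4 * K\<^sup>2)"
  have \<alpha>: "0 < \<alpha>" using m K assms(3) by (simp add: \<alpha>_def)
  have "\<alpha> * entropy \<zeta> \<phi> \<le> fisher M \<zeta> \<phi>"
    if \<zeta>: "\<zeta> \<in> prob_vecs" "\<And>z. c \<le> \<zeta> $ z" and \<phi>: "\<phi> \<in> densities \<zeta>" for \<zeta> \<phi>
  proof -
    have \<zeta>0: "0 < \<zeta> $ z" for z using \<zeta>(2)[of z] assms(3) by linarith
    have \<zeta>1: "(\<Sum>z\<in>UNIV. \<zeta> $ z) = 1" using \<zeta>(1) by (simp add: prob_vecs_def)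
    have \<phi>0: "0 < \<phi> $ z" for z using \<phi> by (simp add: densities_def)
    have E: "(\<Sum>z\<in>UNIV. \<phi> $ z * \<zeta> $ z) = 1" using \<phi> by (simp add: densities_def expect_def)
    have \<phi>_le: "\<phi> $ z \<le> 1 / c" for z
    proof -
      have "\<phi> $ z * c \<le> \<phi> $ z * \<zeta> $ z" using \<zeta>(2) \<phi>0[of z] by (intro mult_left_mono) auto
      also have "\<dots> \<le> (\<Sum>z\<in>UNIV. \<phi> $ z * \<zeta> $ z)"
        using \<zeta>0 \<phi>0 by (intro member_le_sum) (auto simp: less_imp_le)
      finally show ?thesis using E assms(3) by (simp add: field_simps)
    qed
    define d where "d = sqrt (4 * fisher M \<zeta> \<phi> / (m * c * c))"
    have F0: "0 \<le> fisher M \<zeta> \<phi>" by (rule fisher_nonneg[OF assms(1) \<zeta>0 \<phi>0])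
    have d2: "d\<^sup>2 = 4 * fisher M \<zeta> \<phi> / (m * c * c)"
      unfolding d_def using F0 m assms(3) by simp
    have d0: "0 \<le> d" unfolding d_def using F0 m assms(3) by simp
    have edge: "\<bar>\<phi> $ x - \<phi> $ y\<bar> \<le> d" if xy: "0 < M $ x $ y" for x y
    proof -
      let ?g = "\<phi> $ y / \<phi> $ x - 1 - ln (\<phi> $ y / \<phi> $ x)"
      have g: "(\<phi> $ x - \<phi> $ y)\<^sup>2 * c / 4 \<le> \<phi> $ x * ?g"
        using entropy_bregman_ge[OF \<phi>0 \<phi>0 \<phi>_le \<phi>_le, of x y] assms(3) by simp
      then have "0 \<le> \<phi> $ x * ?g" using assms(3) by (smt (verit) divide_nonneg_pos mult_nonneg_nonneg zero_le_power2)
      then have "m * c * ((\<phi> $ x - \<phi> $ y)\<^sup>2 * c / 4) \<le> M $ x $ y * \<zeta> $ x * (\<phi> $ x * ?g)"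
        using m_le[OF xy] \<zeta>(2)[of x] m assms(3) xy g by (intro mult_mono) auto
      also have "\<dots> = M $ x $ y * \<zeta> $ x * \<phi> $ x * ?g" by simp
      also have "\<dots> \<le> (\<Sum>y\<in>UNIV. M $ x $ y * \<zeta> $ x * \<phi> $ x * (\<phi> $ y / \<phi> $ x - 1 - ln (\<phi> $ y / \<phi> $ x)))"
        by (rule member_le_sum) (auto intro!: fisher_summand_nonneg assms \<zeta>0 \<phi>0)
      also have "\<dots> \<le> fisher M \<zeta> \<phi>"
        unfolding fisher_def
        by (rule member_le_sum) (auto intro!: sum_nonneg fisher_summand_nonneg assms \<zeta>0 \<phi>0)
      finally have "(\<phi> $ x - \<phi> $ y)\<^sup>2 \<le> d\<^sup>2"
        unfolding d2 using m assms(3) by (simp add: field_simps)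
      then show ?thesis using d0 by (simp add: abs_le_square_iff[symmetric])
    qed
    have dev: "\<bar>\<phi> $ z - 1\<bar> \<le> K * d" for z
    proof -
      \<comment> \<open>As 1 is the \<zeta>-mean of \<phi>, the deviation from 1 is an average of
        differences of values of \<phi>.\<close>
      have "\<phi> $ z - 1 = (\<Sum>w\<in>UNIV. \<zeta> $ w * (\<phi> $ z - \<phi> $ w))"
        using E \<zeta>1 by (simp add: right_diff_distrib sum_subtractf sum_distrib_right[symmetric] mult.commute[of "\<zeta> $ _"]
          sum_distrib_left[symmetric])
      also have "\<bar>\<dots>\<bar> \<le> (\<Sum>w\<in>UNIV. \<zeta> $ w * (K * d))"
        using diff[OF d0, of "\<lambda>x. \<phi> $ x"] edge \<zeta>0
        by (intro order_trans[OF sum_abs] sum_mono) (simp add: abs_mult less_imp_le)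
      also have "\<dots> = K * d" using \<zeta>1 by (simp add: sum_distrib_right[symmetric])
      finally show ?thesis .
    qed
    have "entropy \<zeta> \<phi> \<le> (\<Sum>z\<in>UNIV. (K * d)\<^sup>2 * \<zeta> $ z)"
      unfolding entropy_alt[OF \<zeta>(1) \<phi>]
    proof (intro sum_mono mult_right_mono)
      fix z
      \<comment> \<open>The bound \<open>ln u \<le> u - 1\<close> makes the entropy integrand at
        most quadratic in \<open>u - 1\<close>.\<close>
      have "\<phi> $ z * ln (\<phi> $ z) \<le> \<phi> $ z * (\<phi> $ z - 1)"
        using ln_le_minus_one[OF \<phi>0[of z]] \<phi>0[of z] by (intro mult_left_mono) auto
      then have "\<phi> $ z * ln (\<phi> $ z) - \<phi> $ z + 1 \<le> (\<phi> $ z - 1)\<^sup>2"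
        by (simp add: power2_eq_square algebra_simps)
      also have "\<dots> \<le> (K * d)\<^sup>2" using power_mono[OF dev[of z], of 2] by simp
      finally show "\<phi> $ z * ln (\<phi> $ z) - \<phi> $ z + 1 \<le> (K * d)\<^sup>2" .
    qed (use \<zeta>0 in \<open>simp add: less_imp_le\<close>)
    also have "\<dots> = K\<^sup>2 * d\<^sup>2" using \<zeta>1 by (simp add: sum_distrib_left[symmetric] power_mult_distrib)
    finally have "\<alpha> * entropy \<zeta> \<phi> \<le> \<alpha> * (K\<^sup>2 * d\<^sup>2)" using \<alpha> by simp
    also have "\<dots> = fisher M \<zeta> \<phi>" unfolding d2 \<alpha>_def using m K assms(3) by (simp add: field_simps)
    finally show ?thesis .
  qed
  then show ?thesis using \<alpha> by blast
qed

section \<open>Variance, second-order expansion and comparison of the two constants\<close>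

lemma var_alt:
  assumes "\<zeta> \<in> prob_vecs"
  shows "var \<zeta> f = (\<Sum>z\<in>UNIV. \<zeta> $ z * (f $ z - expect \<zeta> f)\<^sup>2)"
proof -
  define m where "m = expect \<zeta> f"
  have m: "(\<Sum>z\<in>UNIV. f $ z * \<zeta> $ z) = m" and 1: "(\<Sum>z\<in>UNIV. \<zeta> $ z) = 1"
    using assms by (simp_all add: m_def expect_def prob_vecs_def)
  have "(\<Sum>z\<in>UNIV. \<zeta> $ z * (f $ z - m)\<^sup>2) =
      (\<Sum>z\<in>UNIV. (f $ z)\<^sup>2 * \<zeta> $ z) - 2 * m * (\<Sum>z\<in>UNIV. f $ z * \<zeta> $ z) + m\<^sup>2 * (\<Sum>z\<in>UNIV. \<zeta> $ z)"
    unfolding sum_distrib_left sum_subtractf[symmetric] sum.distrib[symmetric]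
    by (intro sum.cong refl) (simp add: power2_eq_square algebra_simps)
  also have "\<dots> = (\<Sum>z\<in>UNIV. (f $ z)\<^sup>2 * \<zeta> $ z) - m\<^sup>2"
    unfolding m 1 by (simp add: power2_eq_square)
  also have "\<dots> = var \<zeta> f" using m by (simp add: var_def expect_def)
  finally show ?thesis by (simp add: m_def)
qed

lemma var_pos:
  assumes "\<zeta> \<in> prob_vecs" "\<And>z. 0 < \<zeta> $ z" "f \<notin> span {1}"
  shows "0 < var \<zeta> f"
proof -
  have "\<exists>z. f $ z \<noteq> expect \<zeta> f"
  proof (rule ccontr)
    assume "\<nexists>z. f $ z \<noteq> expect \<zeta> f"
    then have "f = expect \<zeta> f *\<^sub>R 1" by (simp add: vec_eq_iff)
    then show False using assms(3) by (metis span_base span_scale insertI1)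
  qed
  then obtain z where z: "f $ z \<noteq> expect \<zeta> f" ..
  show ?thesis
    unfolding var_alt[OF assms(1)]
    by (rule sum_pos2[of _ z]) (use z assms(2) in \<open>auto simp: less_imp_le\<close>)
qed

lemma ln_taylor2_limit: "((\<lambda>e::real. (ln (1 + e * a) - e * a) / e\<^sup>2) \<longlongrightarrow> - a\<^sup>2 / 2) (at_right 0)"
proof (cases a "0::real" rule: linorder_cases)
  case less
  then show ?thesis unfolding power2_eq_square[of a] by real_asymp
next
  case equal
  then show ?thesis by simp
next
  case greater
  then show ?thesis unfolding power2_eq_square[of a] by real_asymp
qed

text \<open>With \<open>ln (1 + e * a) = e * a + e\<^sup>2 * L a e\<close> the terms of order
  \<open>e\<close> cancel. After division by \<open>e\<^sup>2\<close> exactly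
  \<open>(1 + e * a) * (L a e - L b e) + a * (a - b)\<close> remains for small positive
  \<open>e\<close>.\<close>

lemma entropy_bregman_limit:
  fixes a b :: real
  shows "((\<lambda>e. (1 + e * a) * ((1 + e * b) / (1 + e * a) - 1 - ln ((1 + e * b) / (1 + e * a))) / e\<^sup>2)
    \<longlongrightarrow> (a - b)\<^sup>2 / 2) (at_right 0)"
proof -
  define L where "L a e = (ln (1 + e * a) - e * a) / e\<^sup>2" for a e :: real
  have L: "(L a \<longlongrightarrow> - a\<^sup>2 / 2) (at_right 0)" for a
    using ln_taylor2_limit unfolding L_def .
  have "((\<lambda>e. (1 + e * a) * (L a e - L b e) + a * (a - b)) \<longlongrightarrow>
      (1 + 0 * a) * (- a\<^sup>2 / 2 - (- b\<^sup>2 / 2)) + a * (a - b)) (at_right 0)"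
    by (intro tendsto_intros L)
  also have "(1 + 0 * a) * (- a\<^sup>2 / 2 - (- b\<^sup>2 / 2)) + a * (a - b) = (a - b)\<^sup>2 / 2"
    by (simp add: power2_eq_square algebra_simps)
  finally show ?thesis
  proof (rule Lim_transform_eventually)
    have pos: "\<forall>\<^sub>F e in at_right 0. 0 < 1 + e * a" for a :: real
    proof (rule order_tendstoD(1))
      show "((\<lambda>e. 1 + e * a) \<longlongrightarrow> 1 + 0 * a) (at_right 0)" by (intro tendsto_intros)
    qed simp
    show "\<forall>\<^sub>F e in at_right 0. (1 + e * a) * (L a e - L b e) + a * (a - b) =
        (1 + e * a) * ((1 + e * b) / (1 + e * a) - 1 - ln ((1 + e * b) / (1 + e * a))) / e\<^sup>2"
      using pos[of a] pos[of b] eventually_at_right_less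
    proof eventually_elim
      case (elim e)
      define p q where "p = ln (1 + e * a)" and "q = ln (1 + e * b)"
      have "(1 + e * a) * ((1 + e * b) / (1 + e * a) - 1 - (q - p)) = e * b - e * a - (1 + e * a) * (q - p)"
        using elim by (simp add: field_simps)
      moreover have "(1 + e * a) * ((p - e * a) / e\<^sup>2 - (q - e * b) / e\<^sup>2) + a * (a - b) =
          (e * b - e * a - (1 + e * a) * (q - p)) / e\<^sup>2"
        using elim by (simp add: power2_eq_square field_simps)
      ultimately show ?case using elim by (simp add: L_def ln_div p_def q_def)
    qed
  qed
qed

lemma gLSI_ge:
  fixes M :: "real^'z^'z"
  assumes "CARD('z) \<ge> 2" "\<zeta> \<in> prob_vecs" "\<And>z. 0 < \<zeta> $ z"
    and "\<And>\<phi>. \<phi> \<in> densities \<zeta> \<Longrightarrow> \<alpha> * entropy \<zeta> \<phi> \<le> fisher M \<zeta> \<phi>"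
  shows "\<alpha> \<le> gLSI M \<zeta>"
  unfolding gLSI_def
proof (rule cINF_greatest)
  obtain x y :: 'z where xy: "x \<noteq> y"
    using assms(1) by (metis card_2_iff' card_le_Suc0_iff_eq finite not_less_eq_eq numeral_2_eq_2 UNIV_I)
  \<comment> \<open>Doubling the constant 1 at one state and normalising gives a density; the second
    state \<open>y\<close> shows that it is not constant. The infimum therefore ranges over a
    nonempty set.\<close>
  define \<phi> :: "real^'z" where "\<phi> = (\<chi> z. (1 + (if z = x then 1 else 0)) / (1 + \<zeta> $ x))"
  have x: "0 < 1 + \<zeta> $ x" using assms(3)[of x] by simp
  have "(\<Sum>z\<in>UNIV. (1 + (if z = x then 1 else 0)) * \<zeta> $ z) = 1 + \<zeta> $ x"
    using assms(2) by (simp add: distrib_right sum.distrib prob_vecs_def if_distrib[of "\<lambda>a. a * _"] sum.delta cong: if_cong)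
  then have "expect \<zeta> \<phi> = 1"
    using x by (simp add: expect_def \<phi>_def sum_divide_distrib[symmetric])
  then have "\<phi> \<in> densities \<zeta>" using x by (auto simp: densities_def \<phi>_def)
  moreover have "\<phi> \<noteq> 1"
  proof
    assume "\<phi> = 1"
    then have "\<phi> $ x = \<phi> $ y" by simp
    then show False using xy x by (simp add: \<phi>_def)
  qed
  ultimately show "densities \<zeta> - {1} \<noteq> {}" by blast
next
  fix \<phi> assume "\<phi> \<in> densities \<zeta> - {1}"
  then show "\<alpha> \<le> fisher M \<zeta> \<phi> / entropy \<zeta> \<phi>"
    using entropy_pos[OF assms(2,3), of \<phi>] assms(4)[of \<phi>] by (simp add: pos_le_divide_eq)
qed

lemma gLSI_le:
  assumes "generator M" "\<zeta> \<in> prob_vecs" "\<And>z. 0 < \<zeta> $ z" "\<phi> \<in> densities \<zeta>" "\<phi> \<noteq> 1"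
  shows "gLSI M \<zeta> \<le> fisher M \<zeta> \<phi> / entropy \<zeta> \<phi>"
  unfolding gLSI_def
proof (rule cINF_lower)
  show "bdd_below ((\<lambda>\<phi>. fisher M \<zeta> \<phi> / entropy \<zeta> \<phi>) ` (densities \<zeta> - {1}))"
    using fisher_nonneg[OF assms(1,3)] entropy_pos[OF assms(2,3)]
    by (intro bdd_belowI2[of _ 0] divide_nonneg_pos) (auto simp: densities_def)
qed (use assms in simp)

text \<open>The product form also covers constant \<open>f\<close>, whose variance vanishes. This
  matters because the density of two solutions can be the constant 1.\<close>

lemma gPI_le:
  assumes "generator M" "\<zeta> \<in> prob_vecs" "\<And>z. 0 < \<zeta> $ z"
  shows "gPI M \<zeta> * var \<zeta> f \<le> dirichlet M \<zeta> f"
proof (cases "f \<in> span {1}")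
  case True
  then obtain c where "f = c *\<^sub>R 1" by (auto simp: span_singleton)
  then have "var \<zeta> f = 0" using assms(2) by (simp add: var_def expect_def sum_distrib_left[symmetric] prob_vecs_def)
  then show ?thesis using dirichlet_nonneg[OF assms(1,3)] by simp
next
  case False
  have "gPI M \<zeta> \<le> dirichlet M \<zeta> f / var \<zeta> f"
    unfolding gPI_def
  proof (rule cINF_lower)
    show "bdd_below ((\<lambda>f. dirichlet M \<zeta> f / var \<zeta> f) ` {f. f \<notin> span {1}})"
      using dirichlet_nonneg[OF assms(1,3)] var_pos[OF assms(2,3)]
      by (intro bdd_belowI2[of _ 0] divide_nonneg_pos) auto
  qed (use False in simp)
  then show ?thesis using var_pos[OF assms(2,3) False] by (simp add: pos_le_divide_eq)
qed

text \<open>Linearisation at the constant density, along \<open>1 + \<epsilon> (f - expect \<zeta> f)\<close>.\<close>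

lemma gLSI_le_2_gPI:
  fixes M :: "real^'z^'z"
  assumes "CARD('z) \<ge> 2" "generator M" "\<zeta> \<in> prob_vecs" "\<And>z. 0 < \<zeta> $ z"
  shows "gLSI M \<zeta> \<le> 2 * gPI M \<zeta>"
proof -
  have "gLSI M \<zeta> / 2 \<le> gPI M \<zeta>"
    unfolding gPI_def
  proof (rule cINF_greatest)
    show "{f. f \<notin> span {1::real^'z}} \<noteq> {}"
    proof
      assume "{f. f \<notin> span {1::real^'z}} = {}"
      then have "span {1::real^'z} = UNIV" by auto
      then have "dim (UNIV :: (real^'z) set) \<le> card {1::real^'z}"
        by (metis dim_span dim_le_card' finite.emptyI finite_insert)
      then show False using assms(1) by simp
    qed
  next
    fix f assume "f \<in> {f. f \<notin> span {1::real^'z}}"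
    then have V: "0 < var \<zeta> f" using var_pos[OF assms(3,4)] by simp
    define g where "g z = f $ z - expect \<zeta> f" for z
    have g0: "(\<Sum>z\<in>UNIV. \<zeta> $ z * g z) = 0"
      using assms(3) by (simp add: g_def right_diff_distrib sum_subtractf sum_distrib_right[symmetric]
          prob_vecs_def expect_def mult.commute)
    define \<phi> where "\<phi> e = (\<chi> z. 1 + e * g z)" for e
    have "\<exists>z. g z \<noteq> 0"
      using V unfolding var_alt[OF assms(3)] g_def[symmetric] by (rule contrapos_pp) simp
    then obtain z0 where z0: "g z0 \<noteq> 0" ..
    \<comment> \<open>Finitely many states allow one threshold for all positivity constraints; the
      zero mean of \<open>g\<close> preserves normalisation, and \<open>z0\<close> keeps the density
      different from 1.\<close>
    have dens: "\<forall>\<^sub>F e in at_right 0. \<phi> e \<in> densities \<zeta> - {1}"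
    proof -
      have "\<forall>\<^sub>F e in at_right 0. 0 < 1 + e * g z" for z
      proof (rule order_tendstoD(1))
        show "((\<lambda>e. 1 + e * g z) \<longlongrightarrow> 1 + 0 * g z) (at_right 0)" by (intro tendsto_intros)
      qed simp
      then have "\<forall>\<^sub>F e in at_right 0. \<forall>z. 0 < 1 + e * g z"
        by (rule eventually_all_finite)
      then show ?thesis using eventually_at_right_less
      proof eventually_elim
        case (elim e)
        have "expect \<zeta> (\<phi> e) = (\<Sum>z\<in>UNIV. \<zeta> $ z) + e * (\<Sum>z\<in>UNIV. \<zeta> $ z * g z)"
          by (simp add: expect_def \<phi>_def sum_distrib_left sum.distrib[symmetric] algebra_simps)
        then have "expect \<zeta> (\<phi> e) = 1" using g0 assms(3) by (simp add: prob_vecs_def)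
        moreover have "\<phi> e $ z0 \<noteq> 1 $ z0" using z0 elim by (simp add: \<phi>_def)
        then have "\<phi> e \<noteq> 1" by metis
        ultimately show ?case using elim by (simp add: densities_def \<phi>_def)
      qed
    qed
    have limF: "((\<lambda>e. fisher M \<zeta> (\<phi> e) / e\<^sup>2) \<longlongrightarrow> dirichlet M \<zeta> f) (at_right 0)"
    proof -
      have "((\<lambda>e. \<Sum>w\<in>UNIV. \<Sum>z\<in>UNIV. M $ w $ z * \<zeta> $ w * ((1 + e * g w) *
          ((1 + e * g z) / (1 + e * g w) - 1 - ln ((1 + e * g z) / (1 + e * g w))) / e\<^sup>2)) \<longlongrightarrow>
          (\<Sum>w\<in>UNIV. \<Sum>z\<in>UNIV. M $ w $ z * \<zeta> $ w * ((g w - g z)\<^sup>2 / 2))) (at_right 0)"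
        by (intro tendsto_sum tendsto_mult tendsto_const entropy_bregman_limit)
      then show ?thesis
        by (simp add: fisher_def \<phi>_def dirichlet_def g_def sum_divide_distrib sum_distrib_left mult.assoc)
    qed
    have limH: "((\<lambda>e. entropy \<zeta> (\<phi> e) / e\<^sup>2) \<longlongrightarrow> var \<zeta> f / 2) (at_right 0)"
    proof -
      \<comment> \<open>With \<open>b = 0\<close> and \<open>u = 1 + e * g z\<close>, the Bregman
        term is \<open>u * ln u - u + 1\<close>, the entropy integrand, so the same limit serves
        again.\<close>
      have "((\<lambda>e. \<Sum>z\<in>UNIV. \<zeta> $ z * ((1 + e * g z) *
          ((1 + e * 0) / (1 + e * g z) - 1 - ln ((1 + e * 0) / (1 + e * g z))) / e\<^sup>2)) \<longlongrightarrow>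
          (\<Sum>z\<in>UNIV. \<zeta> $ z * ((g z - 0)\<^sup>2 / 2))) (at_right 0)"
        by (intro tendsto_sum tendsto_mult tendsto_const entropy_bregman_limit)
      also have "(\<Sum>z\<in>UNIV. \<zeta> $ z * ((g z - 0)\<^sup>2 / 2)) = var \<zeta> f / 2"
        by (simp add: var_alt[OF assms(3)] g_def sum_divide_distrib)
      finally show ?thesis
      proof (rule Lim_transform_eventually)
        show "\<forall>\<^sub>F e in at_right 0. (\<Sum>z\<in>UNIV. \<zeta> $ z * ((1 + e * g z) *
          ((1 + e * 0) / (1 + e * g z) - 1 - ln ((1 + e * 0) / (1 + e * g z))) / e\<^sup>2)) =
          entropy \<zeta> (\<phi> e) / e\<^sup>2"
          using dens
        proof eventually_elim
          case (elim e)
          then have pos: "0 < 1 + e * g z" for z by (simp add: densities_def \<phi>_def)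
          have "(1 + e * g z) * ((1 + e * 0) / (1 + e * g z) - 1 - ln ((1 + e * 0) / (1 + e * g z))) =
              \<phi> e $ z * ln (\<phi> e $ z) - \<phi> e $ z + 1" for z
            using pos[of z] by (simp add: \<phi>_def ln_div distrib_left right_diff_distrib)
          then show ?case
            using entropy_alt[OF assms(3), of "\<phi> e"] elim
            by (simp add: sum_divide_distrib mult.commute)
        qed
      qed
    qed
    \<comment> \<open>The entropy expands to half the variance, whereas \<open>fisher\<close>
      expands to the full Dirichlet form; this is the origin of the factor 2.\<close>
    have "((\<lambda>e. (fisher M \<zeta> (\<phi> e) / e\<^sup>2) / (entropy \<zeta> (\<phi> e) / e\<^sup>2)) \<longlongrightarrow>
        dirichlet M \<zeta> f / (var \<zeta> f / 2)) (at_right 0)"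
      by (intro tendsto_divide limF limH) (use V in simp)
    then have "gLSI M \<zeta> \<le> dirichlet M \<zeta> f / (var \<zeta> f / 2)"
    proof (rule tendsto_lowerbound)
      show "\<forall>\<^sub>F e in at_right 0. gLSI M \<zeta> \<le> (fisher M \<zeta> (\<phi> e) / e\<^sup>2) / (entropy \<zeta> (\<phi> e) / e\<^sup>2)"
        using dens eventually_at_right_less
        by eventually_elim (use gLSI_le[OF assms(2-4)] in auto)
    qed simp
    then show "gLSI M \<zeta> / 2 \<le> dirichlet M \<zeta> f / var \<zeta> f" by simp
  qed
  then show ?thesis by simp
qed

subsection \<open>Decay of variance and entropy\<close>

text \<open>Absolute continuity ensures that the ratio has mean 1 even when \<zeta> has zeros, so
  the variance is centred at 1.\<close>

lemma rel_var_eq_fdiv: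
  assumes "\<zeta> \<in> prob_vecs" "\<mu> \<in> prob_vecs" "abs_cont \<mu> \<zeta>"
  shows "rel_var \<zeta> \<mu> = ereal (fdiv (\<lambda>x. (x - 1)\<^sup>2) \<zeta> \<mu>)"
proof -
  have "expect \<zeta> (\<chi> z. \<mu> $ z / \<zeta> $ z) = (\<Sum>z\<in>UNIV. \<mu> $ z)"
    unfolding expect_def using assms(3) by (intro sum.cong) (auto simp: abs_cont_def)
  then have "expect \<zeta> (\<chi> z. \<mu> $ z / \<zeta> $ z) = 1" using assms(2) by (simp add: prob_vecs_def)
  then show ?thesis using assms(3) by (simp add: rel_var_def var_alt[OF assms(1)] fdiv_def)
qed

lemma rel_entropy_eq_fdiv:
  assumes "abs_cont \<mu> \<zeta>"
  shows "rel_entropy \<zeta> \<mu> = ereal (fdiv (\<lambda>x. x * ln x) \<zeta> \<mu>)"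
  using assms by (simp add: rel_entropy_def entropy_def fdiv_def mult.commute)

text \<open>The point 0 is included because \<mu> may initially vanish at states charged by
  \<zeta>.\<close>

lemma continuous_on_x_ln_x: "continuous_on {0..} (\<lambda>x::real. x * ln x)"
  unfolding continuous_on_def
proof
  fix x :: real assume x: "x \<in> {0..}"
  show "((\<lambda>x. x * ln x) \<longlongrightarrow> x * ln x) (at x within {0..})"
  proof (cases "x = 0")
    case True
    have "((\<lambda>x::real. x * ln x) \<longlongrightarrow> 0) (at_right 0)" by real_asymp
    then show ?thesis using True by (simp add: at_within_Ici_at_right)
  next
    case False
    then show ?thesis by (intro tendsto_intros) auto
  qed
qed

theorem proposition5p1:
  fixes M :: "real^'z^'z"
  assumes "CARD('z) \<ge> 2" and "generator M" and "irreducible_gen M"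
  shows "\<forall>\<delta>\<in>{0<..<1}. \<exists>\<alpha>>0. \<forall>\<zeta>\<^sub>0\<in>prob_vecs. \<forall>\<mu>\<^sub>0\<in>prob_vecs. \<forall>\<zeta> \<mu>.
    forward_solution M \<zeta>\<^sub>0 \<zeta> \<longrightarrow> forward_solution M \<mu>\<^sub>0 \<mu> \<longrightarrow>
      (\<forall>t\<ge>\<delta>. \<alpha> \<le> gLSI M (\<zeta> t) \<and> gLSI M (\<zeta> t) \<le> 2 * gPI M (\<zeta> t)) \<and>
      (\<forall>t\<ge>0.
        rel_var (\<zeta> t) (\<mu> t) \<le> rel_var \<zeta>\<^sub>0 \<mu>\<^sub>0 * ereal (min 1 (exp (- \<alpha> * (t - \<delta>)))) \<and>
        rel_entropy (\<zeta> t) (\<mu> t) \<le> rel_entropy \<zeta>\<^sub>0 \<mu>\<^sub>0 * ereal (min 1 (exp (- \<alpha> * (t - \<delta>)))))"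
proof
  fix \<delta> :: real assume "\<delta> \<in> {0<..<1}"
  then have \<delta>: "0 < \<delta>" "\<delta> \<le> 1" by auto
  obtain c where c: "0 < c" and lower: "\<And>p x t z. forward_solution M p x \<Longrightarrow> p \<in> prob_vecs \<Longrightarrow>
      \<delta> \<le> t \<Longrightarrow> c \<le> x t $ z"
    using forward_solution_uniform_lower_bound[OF assms(2,3) \<delta>] by blast
  obtain \<alpha> where \<alpha>: "0 < \<alpha>" and LSI: "\<And>\<zeta> \<phi>. \<zeta> \<in> prob_vecs \<Longrightarrow> (\<And>z. c \<le> \<zeta> $ z) \<Longrightarrow>
      \<phi> \<in> densities \<zeta> \<Longrightarrow> \<alpha> * entropy \<zeta> \<phi> \<le> fisher M \<zeta> \<phi>"
    using fisher_ge_entropy[OF assms(2,3) c] by blast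
  \<comment> \<open>Using \<open>min t 1\<close> as delay gives a bound depending on
    \<open>t\<close>, which suffices for positivity at every positive time.\<close>
  have pos: "0 < x t $ z" if x: "forward_solution M p x" "p \<in> prob_vecs" and t: "0 < t" for p x t z
  proof -
    obtain c' where "0 < c'" "c' \<le> x t $ z"
      using forward_solution_uniform_lower_bound[OF assms(2,3), of "min t 1"] x t
      by (metis min.cobounded1 min.cobounded2 min_less_iff_conj zero_less_one)
    then show ?thesis by linarith
  qed
  show "\<exists>\<alpha>>0. \<forall>\<zeta>\<^sub>0\<in>prob_vecs. \<forall>\<mu>\<^sub>0\<in>prob_vecs. \<forall>\<zeta> \<mu>.
    forward_solution M \<zeta>\<^sub>0 \<zeta> \<longrightarrow> forward_solution M \<mu>\<^sub>0 \<mu> \<longrightarrow>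
      (\<forall>t\<ge>\<delta>. \<alpha> \<le> gLSI M (\<zeta> t) \<and> gLSI M (\<zeta> t) \<le> 2 * gPI M (\<zeta> t)) \<and>
      (\<forall>t\<ge>0.
        rel_var (\<zeta> t) (\<mu> t) \<le> rel_var \<zeta>\<^sub>0 \<mu>\<^sub>0 * ereal (min 1 (exp (- \<alpha> * (t - \<delta>)))) \<and>
        rel_entropy (\<zeta> t) (\<mu> t) \<le> rel_entropy \<zeta>\<^sub>0 \<mu>\<^sub>0 * ereal (min 1 (exp (- \<alpha> * (t - \<delta>)))))"
  proof (rule exI[of _ \<alpha>], intro conjI ballI allI impI)
    show "0 < \<alpha>" by (rule \<alpha>)
  next
    fix \<zeta>\<^sub>0 \<mu>\<^sub>0 :: "real^'z" and \<zeta> \<mu> :: "real \<Rightarrow> real^'z"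
    assume p: "\<zeta>\<^sub>0 \<in> prob_vecs" and q: "\<mu>\<^sub>0 \<in> prob_vecs"
      and \<zeta>: "forward_solution M \<zeta>\<^sub>0 \<zeta>" and \<mu>: "forward_solution M \<mu>\<^sub>0 \<mu>"
    have \<zeta>p: "\<zeta> t \<in> prob_vecs" and \<mu>p: "\<mu> t \<in> prob_vecs" if "0 \<le> t" for t
      using forward_solution_prob_vecs[OF assms(2) \<zeta> p that]
        forward_solution_prob_vecs[OF assms(2) \<mu> q that] by auto
    have \<zeta>0: "0 < \<zeta> t $ z" and \<mu>0: "0 < \<mu> t $ z" if "0 < t" for t z
      using pos[OF \<zeta> p that] pos[OF \<mu> q that] by auto
    have LSI_t: "\<alpha> \<le> gLSI M (\<zeta> t)" if "\<delta> \<le> t" for t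
      using that \<delta> by (intro gLSI_ge[OF assms(1) \<zeta>p \<zeta>0] LSI \<zeta>p lower[OF \<zeta> p]) auto
    have PI_t: "gLSI M (\<zeta> t) \<le> 2 * gPI M (\<zeta> t)" if "\<delta> \<le> t" for t
      using that \<delta> by (intro gLSI_le_2_gPI[OF assms(1,2) \<zeta>p \<zeta>0]) auto
    define \<phi> where "\<phi> t = (\<chi> z. \<mu> t $ z / \<zeta> t $ z)" for t
    have \<phi>0: "0 < \<phi> t $ z" if "0 < t" for t z
      using \<zeta>0[OF that] \<mu>0[OF that] by (simp add: \<phi>_def)
    have \<phi>1: "expect (\<zeta> t) (\<phi> t) = 1" if "0 < t" for t
    proof -
      have "expect (\<zeta> t) (\<phi> t) = (\<Sum>z\<in>UNIV. \<mu> t $ z)"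
        unfolding expect_def \<phi>_def using \<zeta>0[OF that] by (intro sum.cong) (auto simp: less_imp_neq[symmetric])
      then show ?thesis using \<mu>p[of t] that by (simp add: prob_vecs_def)
    qed
    have \<phi>d: "\<phi> t \<in> densities (\<zeta> t)" if "0 < t" for t
      using \<phi>0[OF that] \<phi>1[OF that] by (simp add: densities_def)
    have V: "fdiv (\<lambda>x. (x - 1)\<^sup>2) (\<zeta> t) (\<mu> t) = var (\<zeta> t) (\<phi> t)" if "0 < t" for t
      using \<phi>1[OF that] \<zeta>p[of t] that by (simp add: var_alt fdiv_def) (simp add: \<phi>_def)
    have H: "fdiv (\<lambda>x. x * ln x) (\<zeta> t) (\<mu> t) = entropy (\<zeta> t) (\<phi> t)" for t
      by (simp add: fdiv_def entropy_def \<phi>_def mult.commute)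
    have V_deriv: "((\<lambda>t. fdiv (\<lambda>x. (x - 1)\<^sup>2) (\<zeta> t) (\<mu> t)) has_real_derivative
        - (2 * dirichlet M (\<zeta> t) (\<phi> t))) (at t)" if "0 < t" for t
    proof (rule DERIV_cong[OF fdiv_DERIV[where h' = "\<lambda>x. 2 * (x - 1)", OF assms(2) \<zeta> \<mu> that \<zeta>0[OF that] \<mu>0[OF that]]])
      show "((\<lambda>x. (x - 1)\<^sup>2) has_real_derivative 2 * (x - 1)) (at x)" for x :: real
        by (auto intro!: derivative_eq_intros)
      \<comment> \<open>The Bregman divergence of the quadratic is an exact square, so dissipation
        is twice the Dirichlet form.\<close>
      have "(a - 1)\<^sup>2 - (b - 1)\<^sup>2 - 2 * (b - 1) * (a - b) = (a - b)\<^sup>2" for a b :: real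
        by (simp add: power2_eq_square algebra_simps)
      then show "- (\<Sum>w\<in>UNIV. \<Sum>z\<in>UNIV. M $ w $ z * \<zeta> t $ w *
          ((\<mu> t $ w / \<zeta> t $ w - 1)\<^sup>2 - (\<mu> t $ z / \<zeta> t $ z - 1)\<^sup>2 -
          2 * (\<mu> t $ z / \<zeta> t $ z - 1) * (\<mu> t $ w / \<zeta> t $ w - \<mu> t $ z / \<zeta> t $ z))) =
          - (2 * dirichlet M (\<zeta> t) (\<phi> t))"
        by (simp only: dirichlet_def \<phi>_def vec_lambda_beta)
    qed
    have H_deriv: "((\<lambda>t. fdiv (\<lambda>x. x * ln x) (\<zeta> t) (\<mu> t)) has_real_derivative
        - fisher M (\<zeta> t) (\<phi> t)) (at t)" if "0 < t" for t
    proof (rule DERIV_cong[OF fdiv_DERIV[where h' = "\<lambda>x. ln x + 1", OF assms(2) \<zeta> \<mu> that \<zeta>0[OF that] \<mu>0[OF that]]])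
      show "((\<lambda>x. x * ln x) has_real_derivative ln x + 1) (at x)" if "0 < x" for x :: real
        using that by (auto intro!: derivative_eq_intros)
      have bregman: "a * ln a - b * ln b - (ln b + 1) * (a - b) = a * (b / a - 1 - ln (b / a))"
        if "0 < a" "0 < b" for a b :: real
        using that by (simp add: ln_div algebra_simps)
      have ratio: "0 < \<mu> t $ z / \<zeta> t $ z" for z using \<phi>0[OF that, of z] by (simp add: \<phi>_def)
      show "- (\<Sum>w\<in>UNIV. \<Sum>z\<in>UNIV. M $ w $ z * \<zeta> t $ w *
          (\<mu> t $ w / \<zeta> t $ w * ln (\<mu> t $ w / \<zeta> t $ w) - \<mu> t $ z / \<zeta> t $ z * ln (\<mu> t $ z / \<zeta> t $ z) -
          (ln (\<mu> t $ z / \<zeta> t $ z) + 1) * (\<mu> t $ w / \<zeta> t $ w - \<mu> t $ z / \<zeta> t $ z))) =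
          - fisher M (\<zeta> t) (\<phi> t)"
        by (simp only: bregman[OF ratio ratio] fisher_def \<phi>_def vec_lambda_beta mult.assoc)
    qed
    have ac: "abs_cont (\<mu> t) (\<zeta> t)" if "0 < t" for t
      using \<zeta>0[OF that] by (auto simp: abs_cont_def less_imp_neq[symmetric])
    \<comment> \<open>The decay factor is strictly positive, which excludes the product of infinity
      and 0, equal to 0 in \<open>ereal\<close>.\<close>
    have infinite: "\<infinity> * ereal (min 1 (exp (- \<alpha> * (t - \<delta>)))) = \<infinity>" for t
    proof -
      have "\<infinity> * ereal b = \<infinity>" if "0 < b" for b using that by simp
      then show ?thesis by this simp
    qed
    have at0: "\<zeta> 0 = \<zeta>\<^sub>0" "\<mu> 0 = \<mu>\<^sub>0" using \<zeta> \<mu> by (auto simp: forward_solution_def)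
    have "min 1 (exp (- \<alpha> * (0 - \<delta>))) = 1" using \<alpha> \<delta> by simp
    then have initial: "A \<le> A * ereal (min 1 (exp (- \<alpha> * (0 - \<delta>))))" for A
      by (simp only: one_ereal_def[symmetric]) simp
    {
      fix t assume t: "\<delta> \<le> t"
      show "\<alpha> \<le> gLSI M (\<zeta> t)" "gLSI M (\<zeta> t) \<le> 2 * gPI M (\<zeta> t)"
        using LSI_t[OF t] PI_t[OF t] .
    next
      fix t :: real assume t: "0 \<le> t"
      show "rel_var (\<zeta> t) (\<mu> t) \<le> rel_var \<zeta>\<^sub>0 \<mu>\<^sub>0 * ereal (min 1 (exp (- \<alpha> * (t - \<delta>))))"
      \<comment> \<open>At time 0 the decay factor is 1, and without absolute continuity the
        right-hand side is infinite. Only the remaining case needs the dissipation estimate.\<close>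
      proof (cases "t = 0 \<or> \<not> abs_cont \<mu>\<^sub>0 \<zeta>\<^sub>0")
        case True
        then show ?thesis
        proof
          assume "t = 0"
          then show ?thesis using initial at0 by metis
        next
          assume "\<not> abs_cont \<mu>\<^sub>0 \<zeta>\<^sub>0"
          then have "rel_var \<zeta>\<^sub>0 \<mu>\<^sub>0 = \<infinity>" by (simp add: rel_var_def)
          then show ?thesis by (simp only: infinite) simp
        qed
      next
        case False
        then have t0: "0 < t" and ac0: "abs_cont \<mu>\<^sub>0 \<zeta>\<^sub>0" using t by auto
        have "fdiv (\<lambda>x. (x - 1)\<^sup>2) (\<zeta> t) (\<mu> t) \<le>
            fdiv (\<lambda>x. (x - 1)\<^sup>2) \<zeta>\<^sub>0 \<mu>\<^sub>0 * min 1 (exp (- \<alpha> * (t - \<delta>)))"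
        proof (rule exp_decay_from_limit[OF tendsto_fdiv_0[OF assms(2) \<zeta> \<mu> p q ac0 \<zeta>0] V_deriv])
          show "continuous_on {0..} (\<lambda>x::real. (x - 1)\<^sup>2)" by (intro continuous_intros)
          show "0 \<le> 2 * dirichlet M (\<zeta> t) (\<phi> t)" if "0 < t" for t
            using dirichlet_nonneg[OF assms(2) \<zeta>0[OF that]] by simp
          show "\<alpha> * fdiv (\<lambda>x. (x - 1)\<^sup>2) (\<zeta> t) (\<mu> t) \<le> 2 * dirichlet M (\<zeta> t) (\<phi> t)" if "\<delta> \<le> t" for t
          proof -
            have t0: "0 < t" using that \<delta> by simp
            have "0 \<le> var (\<zeta> t) (\<phi> t)"
              using \<zeta>0[OF t0] \<zeta>p[of t] t0 by (simp add: var_alt sum_nonneg less_imp_le)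
            \<comment> \<open>The chain from \<alpha> through \<open>gLSI\<close> to
              \<open>2 * gPI\<close> lets the entropy constant also drive the decay of the
              variance.\<close>
            then have "\<alpha> * var (\<zeta> t) (\<phi> t) \<le> 2 * gPI M (\<zeta> t) * var (\<zeta> t) (\<phi> t)"
              using LSI_t[OF that] PI_t[OF that] by (intro mult_right_mono) auto
            then show ?thesis
              using gPI_le[OF assms(2) \<zeta>p \<zeta>0[OF t0], of "\<phi> t"] V[OF t0] t0 by simp
          qed
        qed (use \<alpha> \<delta> t0 in auto)
        then show ?thesis
          by (simp only: rel_var_eq_fdiv[OF \<zeta>p[OF t] \<mu>p[OF t] ac[OF t0]] rel_var_eq_fdiv[OF p q ac0]
              times_ereal.simps ereal_less_eq)
      qed
      show "rel_entropy (\<zeta> t) (\<mu> t) \<le> rel_entropy \<zeta>\<^sub>0 \<mu>\<^sub>0 * ereal (min 1 (exp (- \<alpha> * (t - \<delta>))))"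
      proof (cases "t = 0 \<or> \<not> abs_cont \<mu>\<^sub>0 \<zeta>\<^sub>0")
        case True
        then show ?thesis
        proof
          assume "t = 0"
          then show ?thesis using initial at0 by metis
        next
          assume "\<not> abs_cont \<mu>\<^sub>0 \<zeta>\<^sub>0"
          then have "rel_entropy \<zeta>\<^sub>0 \<mu>\<^sub>0 = \<infinity>" by (simp add: rel_entropy_def)
          then show ?thesis by (simp only: infinite) simp
        qed
      next
        case False
        then have t0: "0 < t" and ac0: "abs_cont \<mu>\<^sub>0 \<zeta>\<^sub>0" using t by auto
        have "fdiv (\<lambda>x. x * ln x) (\<zeta> t) (\<mu> t) \<le>
            fdiv (\<lambda>x. x * ln x) \<zeta>\<^sub>0 \<mu>\<^sub>0 * min 1 (exp (- \<alpha> * (t - \<delta>)))"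
        proof (rule exp_decay_from_limit[OF tendsto_fdiv_0[OF assms(2) \<zeta> \<mu> p q ac0 \<zeta>0 continuous_on_x_ln_x] H_deriv])
          show "0 \<le> fisher M (\<zeta> t) (\<phi> t)" if "0 < t" for t
            using fisher_nonneg[OF assms(2) \<zeta>0[OF that] \<phi>0[OF that]] .
          show "\<alpha> * fdiv (\<lambda>x. x * ln x) (\<zeta> t) (\<mu> t) \<le> fisher M (\<zeta> t) (\<phi> t)" if "\<delta> \<le> t" for t
            unfolding H using that \<delta> by (intro LSI \<zeta>p \<phi>d lower[OF \<zeta> p]) auto
        qed (use \<alpha> \<delta> t0 in auto)
        then show ?thesis
          by (simp only: rel_entropy_eq_fdiv[OF ac[OF t0]] rel_entropy_eq_fdiv[OF ac0]
              times_ereal.simps ereal_less_eq)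
      qed
    }
  qed
qed

end
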